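(* Let $L$ be a vocabulary with maximum relation arity $k$. For every $L$-structure $M$ of order $n$, $$W_1(M) < \left(1-\frac{1}{2k}\right)n + k^2 - k + 2,$$ where $W_1(M)$ is the minimum quantifier rank of a first-order formula with alternation number at most $1$ that identifies $M$.
   Context: A vocabulary $L$ is a finite list of relation symbols, each with a positive integer arity; its maximum relation arity is the largest of these arities. An $L$-structure $M$ consists of a finite universe $V(M)$ and, for each $l$-ary symbol $R$ of $L$, a relation $R^M: V(M)^l\to\{0,1\}$. The order of $M$ is $|V(M)|$. First-order formulas are built from atomic formulas over $L\cup\{=\}$ using $\neg,\wedge,\vee,\exists,\forall$. To each formula $\Phi$ associate a set $\mathrm{nest}(\Phi)$ of words over $\{\exists,\forall\}$: $\mathrm{nest}(\Phi)=\{\text{empty word}\}$ for atomic $\Phi$; $\mathrm{nest}(\neg\Phi)$ is obtained from $\mathrm{nest}(\Phi)$ by swapping $\exists$ and $\forall$ in every word; $\mathrm{nest}(\Phi\wedge\Psi)=\mathrm{nest}(\Phi\vee\Psi)=\mathrm{nest}(\Phi)\cup\mathrm{nest}(\Psi)$; $\mathrm{nest}(\exists x\Phi)$ (resp. $\mathrm{nest}(\forall x\Phi)$) is obtained by prefixing $\exists$ (resp. $\forall$) to every word of $\mathrm{nest}(\Phi)$. The quantifier rank of $\Phi$ is the maximum length of a word in $\mathrm{nest}(\Phi)$; the alternation number of $\Phi$ is the maximum, over words in $\mathrm{nest}(\Phi)$, of the number of occurrences of $\exists\forall$ and $\forall\exists$ as consecutive letters. A closed formula $\Phi$ distinguishes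 $M$ from $M'$ if $\Phi$ is true on $M$ and false on $M'$. $\Phi$ identifies an $L$-structure $M$ of order $n$ if it distinguishes $M$ from every $L$-structure of order $n$ not isomorphic to $M$. *)

theory Defs
  imports "HOL-Library.Extended_Real"
begin

section \<open>Vocabularies, structures, isomorphism\<close>

text \<open>A vocabulary is the list of the arities of its relation symbols; the symbols themselves are
  the positions in this list.\<close>

type_synonym vocabulary = "nat list"

definition is_vocabulary :: "vocabulary \<Rightarrow> bool" where
  "is_vocabulary L \<longleftrightarrow> (\<forall>l\<in>set L. 0 < l)"

definition max_arity :: "vocabulary \<Rightarrow> nat" where
  "max_arity L = Max (set L)"

record 'a struct =
  univ :: "'a set"
  rel :: "nat \<Rightarrow> 'a list \<Rightarrow> bool"

definition tuples :: "'a set \<Rightarrow> nat \<Rightarrow> 'a list set" where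
  "tuples V l = {xs. length xs = l \<and> set xs \<subseteq> V}"

text \<open>The relation of the \<open>i\<close>-th symbol is a predicate on \<open>tuples (univ M) (L ! i)\<close>, extended by
  \<open>False\<close> to a total function.\<close>

definition is_structure :: "vocabulary \<Rightarrow> 'a struct \<Rightarrow> bool" where
  "is_structure L M \<longleftrightarrow> finite (univ M) \<and>
     (\<forall>i xs. rel M i xs \<longrightarrow> i < length L \<and> xs \<in> tuples (univ M) (L ! i))"

definition isomorphic :: "vocabulary \<Rightarrow> 'a struct \<Rightarrow> 'b struct \<Rightarrow> bool" where
  "isomorphic L M N \<longleftrightarrow> (\<exists>f. bij_betw f (univ M) (univ N) \<and>
     (\<forall>i<length L. \<forall>xs\<in>tuples (univ M) (L ! i). rel M i xs \<longleftrightarrow> rel N i (map f xs)))"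

section \<open>First-order formulas\<close>

datatype fm =
    Rel nat "nat list"
  | Eq nat nat
  | Neg fm
  | Conj fm fm
  | Disj fm fm
  | Exi nat fm
  | Uni nat fm

fun formula :: "vocabulary \<Rightarrow> fm \<Rightarrow> bool" where
  "formula L (Rel i xs) \<longleftrightarrow> i < length L \<and> length xs = L ! i"
| "formula L (Eq x y) \<longleftrightarrow> True"
| "formula L (Neg \<phi>) \<longleftrightarrow> formula L \<phi>"
| "formula L (Conj \<phi> \<psi>) \<longleftrightarrow> formula L \<phi> \<and> formula L \<psi>"
| "formula L (Disj \<phi> \<psi>) \<longleftrightarrow> formula L \<phi> \<and> formula L \<psi>"
| "formula L (Exi x \<phi>) \<longleftrightarrow> formula L \<phi>"
| "formula L (Uni x \<phi>) \<longleftrightarrow> formula L \<phi>"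

fun fv :: "fm \<Rightarrow> nat set" where
  "fv (Rel i xs) = set xs"
| "fv (Eq x y) = {x, y}"
| "fv (Neg \<phi>) = fv \<phi>"
| "fv (Conj \<phi> \<psi>) = fv \<phi> \<union> fv \<psi>"
| "fv (Disj \<phi> \<psi>) = fv \<phi> \<union> fv \<psi>"
| "fv (Exi x \<phi>) = fv \<phi> - {x}"
| "fv (Uni x \<phi>) = fv \<phi> - {x}"

definition sentence :: "vocabulary \<Rightarrow> fm \<Rightarrow> bool" where
  "sentence L \<phi> \<longleftrightarrow> formula L \<phi> \<and> fv \<phi> = {}"

fun sat :: "'a struct \<Rightarrow> (nat \<Rightarrow> 'a) \<Rightarrow> fm \<Rightarrow> bool" where
  "sat M \<sigma> (Rel i xs) \<longleftrightarrow> rel M i (map \<sigma> xs)"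
| "sat M \<sigma> (Eq x y) \<longleftrightarrow> \<sigma> x = \<sigma> y"
| "sat M \<sigma> (Neg \<phi>) \<longleftrightarrow> \<not> sat M \<sigma> \<phi>"
| "sat M \<sigma> (Conj \<phi> \<psi>) \<longleftrightarrow> sat M \<sigma> \<phi> \<and> sat M \<sigma> \<psi>"
| "sat M \<sigma> (Disj \<phi> \<psi>) \<longleftrightarrow> sat M \<sigma> \<phi> \<or> sat M \<sigma> \<psi>"
| "sat M \<sigma> (Exi x \<phi>) \<longleftrightarrow> (\<exists>a\<in>univ M. sat M (\<sigma>(x := a)) \<phi>)"
| "sat M \<sigma> (Uni x \<phi>) \<longleftrightarrow> (\<forall>a\<in>univ M. sat M (\<sigma>(x := a)) \<phi>)"

text \<open>Meant for sentences only, for which the choice of \<open>\<sigma>\<close> does not matter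
  (lemma \<open>true_on_iff\<close> below).\<close>

definition true_on :: "'a struct \<Rightarrow> fm \<Rightarrow> bool" where
  "true_on M \<phi> \<longleftrightarrow> (\<forall>\<sigma>. sat M \<sigma> \<phi>)"

section \<open>Quantifier rank and alternation number\<close>

datatype quantifier = Ex_q | All_q

fun swap_q :: "quantifier \<Rightarrow> quantifier" where
  "swap_q Ex_q = All_q"
| "swap_q All_q = Ex_q"

fun nest :: "fm \<Rightarrow> quantifier list set" where
  "nest (Rel i xs) = {[]}"
| "nest (Eq x y) = {[]}"
| "nest (Neg \<phi>) = map swap_q ` nest \<phi>"
| "nest (Conj \<phi> \<psi>) = nest \<phi> \<union> nest \<psi>"
| "nest (Disj \<phi> \<psi>) = nest \<phi> \<union> nest \<psi>"
| "nest (Exi x \<phi>) = Cons Ex_q ` nest \<phi>"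
| "nest (Uni x \<phi>) = Cons All_q ` nest \<phi>"

definition quantifier_rank :: "fm \<Rightarrow> nat" where
  "quantifier_rank \<phi> = Max (length ` nest \<phi>)"

definition alternations :: "quantifier list \<Rightarrow> nat" where
  "alternations w = card {i. Suc i < length w \<and> w ! i \<noteq> w ! Suc i}"

definition alternation_number :: "fm \<Rightarrow> nat" where
  "alternation_number \<phi> = Max (alternations ` nest \<phi>)"

section \<open>Identification\<close>

definition distinguishes :: "fm \<Rightarrow> 'a struct \<Rightarrow> 'b struct \<Rightarrow> bool" where
  "distinguishes \<phi> M N \<longleftrightarrow> true_on M \<phi> \<and> \<not> true_on N \<phi>"

text \<open>\<open>N\<close> ranges over structures with elements of the same type as those of \<open>M\<close>. This is no
  restriction: see lemma \<open>identifies_any_type\<close> below.\<close>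

definition identifies :: "vocabulary \<Rightarrow> fm \<Rightarrow> 'a struct \<Rightarrow> bool" where
  "identifies L \<phi> M \<longleftrightarrow> sentence L \<phi> \<and>
     (\<forall>N :: 'a struct. is_structure L N \<and> card (univ N) = card (univ M) \<and> \<not> isomorphic L M N
        \<longrightarrow> distinguishes \<phi> M N)"

text \<open>The minimum is taken in \<open>enat\<close>, so that it is \<open>\<infinity>\<close> (rather than some arbitrary
  number) if no formula as required exists; see lemma \<open>W_eq_enat_iff\<close> below.\<close>

definition W :: "nat \<Rightarrow> vocabulary \<Rightarrow> 'a struct \<Rightarrow> enat" where
  "W a L M = (INF \<phi> \<in> {\<phi>. identifies L \<phi> M \<and> alternation_number \<phi> \<le> a}.
     enat (quantifier_rank \<phi>))"

section \<open>Basic properties\<close>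

lemma W_eq_enat_iff:
  "W a L M = enat q \<longleftrightarrow>
     (\<exists>\<phi>. identifies L \<phi> M \<and> alternation_number \<phi> \<le> a \<and> quantifier_rank \<phi> = q) \<and>
     (\<forall>\<phi>. identifies L \<phi> M \<and> alternation_number \<phi> \<le> a \<longrightarrow> q \<le> quantifier_rank \<phi>)"
  (is "?l \<longleftrightarrow> ?r")
proof
  let ?S = "(\<lambda>\<phi>. enat (quantifier_rank \<phi>)) ` {\<phi>. identifies L \<phi> M \<and> alternation_number \<phi> \<le> a}"
  assume l: ?l
  have ne: "?S \<noteq> {}"
  proof
    assume "?S = {}"
    with l show False by (simp add: W_def Inf_enat_def)
  qed
  then obtain s where "s \<in> ?S" by blast
  then have "Inf ?S \<in> ?S" unfolding Inf_enat_def using ne by (auto intro: LeastI)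
  moreover have "Inf ?S \<le> s" if "s \<in> ?S" for s using that by (rule Inf_lower)
  ultimately have "enat q \<in> ?S" and "\<forall>s\<in>?S. enat q \<le> s" using l unfolding W_def by metis+
  then show ?r by auto
next
  assume ?r
  then show ?l unfolding W_def
    by (intro antisym INF_greatest) (auto intro!: INF_lower2)
qed

lemma sat_cong_fv: "(\<And>x. x \<in> fv \<phi> \<Longrightarrow> \<sigma> x = \<tau> x) \<Longrightarrow> sat M \<sigma> \<phi> \<longleftrightarrow> sat M \<tau> \<phi>"
proof (induction \<phi> arbitrary: \<sigma> \<tau>)
  case (Rel i xs)
  then have "map \<sigma> xs = map \<tau> xs" by simp
  then show ?case by (metis sat.simps(1))
next
  case (Exi x \<phi>)
  have "sat M (\<sigma>(x := a)) \<phi> \<longleftrightarrow> sat M (\<tau>(x := a)) \<phi>" for a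
    using Exi.prems by (intro Exi.IH) auto
  then show ?case by simp
next
  case (Uni x \<phi>)
  have "sat M (\<sigma>(x := a)) \<phi> \<longleftrightarrow> sat M (\<tau>(x := a)) \<phi>" for a
    using Uni.prems by (intro Uni.IH) auto
  then show ?case by simp
next
  case (Conj \<phi> \<psi>)
  from Conj.IH[of \<sigma> \<tau>] Conj.prems show ?case by simp
next
  case (Disj \<phi> \<psi>)
  from Disj.IH[of \<sigma> \<tau>] Disj.prems show ?case by simp
next
  case (Neg \<phi>)
  from Neg.IH[of \<sigma> \<tau>] Neg.prems show ?case by simp
qed simp

lemma true_on_iff:
  assumes "sentence L \<phi>"
  shows "true_on M \<phi> \<longleftrightarrow> sat M \<sigma> \<phi>"
  using sat_cong_fv[of \<phi> _ \<sigma> M] assms unfolding true_on_def sentence_def by auto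

lemma sat_isomorphism:
  assumes bij: "bij_betw f (univ M) (univ N)"
    and hom: "\<And>i xs. i < length L \<Longrightarrow> xs \<in> tuples (univ M) (L ! i) \<Longrightarrow>
      rel M i xs \<longleftrightarrow> rel N i (map f xs)"
  shows "formula L \<phi> \<Longrightarrow> \<sigma> ` fv \<phi> \<subseteq> univ M \<Longrightarrow> sat M \<sigma> \<phi> \<longleftrightarrow> sat N (f \<circ> \<sigma>) \<phi>"
proof (induction \<phi> arbitrary: \<sigma>)
  case (Rel i xs)
  then show ?case using hom[of i "map \<sigma> xs"] by (auto simp: tuples_def comp_def)
next
  case (Eq x y)
  then show ?case using bij by (auto simp: bij_betw_def inj_on_eq_iff)
next
  case (Exi x \<phi>)
  have "sat M (\<sigma>(x := a)) \<phi> \<longleftrightarrow> sat N ((f \<circ> \<sigma>)(x := f a)) \<phi>" if "a \<in> univ M" for a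
  proof -
    have "f \<circ> \<sigma>(x := a) = (f \<circ> \<sigma>)(x := f a)" by auto
    moreover have "(\<sigma>(x := a)) ` fv \<phi> \<subseteq> univ M" using Exi.prems that by auto
    ultimately show ?thesis using Exi.IH[of "\<sigma>(x := a)"] Exi.prems(1) by (metis formula.simps(6,7))
  qed
  moreover have "univ N = f ` univ M" using bij by (simp add: bij_betw_def)
  ultimately show ?case by (auto simp: comp_def)
next
  case (Uni x \<phi>)
  have "sat M (\<sigma>(x := a)) \<phi> \<longleftrightarrow> sat N ((f \<circ> \<sigma>)(x := f a)) \<phi>" if "a \<in> univ M" for a
  proof -
    have "f \<circ> \<sigma>(x := a) = (f \<circ> \<sigma>)(x := f a)" by auto
    moreover have "(\<sigma>(x := a)) ` fv \<phi> \<subseteq> univ M" using Uni.prems that by auto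
    ultimately show ?thesis using Uni.IH[of "\<sigma>(x := a)"] Uni.prems(1) by (metis formula.simps(6,7))
  qed
  moreover have "univ N = f ` univ M" using bij by (simp add: bij_betw_def)
  ultimately show ?case by (auto simp: comp_def)
qed (auto simp: image_Un)

lemma true_on_isomorphic:
  assumes "isomorphic L M N" "sentence L \<phi>"
  shows "true_on M \<phi> \<longleftrightarrow> true_on N \<phi>"
proof -
  from assms(1) obtain f where "bij_betw f (univ M) (univ N)"
    and "\<And>i xs. i < length L \<Longrightarrow> xs \<in> tuples (univ M) (L ! i) \<Longrightarrow>
      rel M i xs \<longleftrightarrow> rel N i (map f xs)"
    unfolding isomorphic_def by blast
  from sat_isomorphism[OF this, of L \<phi> undefined] assms(2)
  show ?thesis by (simp add: true_on_iff[OF assms(2)] sentence_def)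
    (metis assms(2) true_on_iff)
qed

lemma identifies_any_type:
  fixes M :: "'a struct" and N :: "'b struct"
  assumes M: "is_structure L M" and N: "is_structure L N" and card: "card (univ N) = card (univ M)"
    and not_iso: "\<not> isomorphic L M N" and id: "identifies L \<phi> M"
  shows "distinguishes \<phi> M N"
proof -
  from M N card obtain g where g: "bij_betw g (univ M) (univ N)"
    unfolding is_structure_def using finite_same_card_bij by metis
  define P :: "'a struct" where "P = \<lparr>univ = univ M,
    rel = \<lambda>i xs. i < length L \<and> xs \<in> tuples (univ M) (L ! i) \<and> rel N i (map g xs)\<rparr>"
  have P: "is_structure L P" using M by (auto simp: is_structure_def P_def)
  have PN: "isomorphic L P N"
    unfolding isomorphic_def using g by (intro exI[of _ g]) (auto simp: P_def)
  have "\<not> isomorphic L M P"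
  proof
    assume "isomorphic L M P"
    then obtain f where f: "bij_betw f (univ M) (univ M)"
      and h: "\<forall>i<length L. \<forall>xs\<in>tuples (univ M) (L ! i). rel M i xs \<longleftrightarrow> rel P i (map f xs)"
      unfolding isomorphic_def by (auto simp: P_def)
    have "map f xs \<in> tuples (univ M) l" if "xs \<in> tuples (univ M) l" for xs l
      using that f by (auto simp: tuples_def bij_betw_def)
    with h have hom: "rel M i xs \<longleftrightarrow> rel N i (map g (map f xs))"
      if "i < length L" "xs \<in> tuples (univ M) (L ! i)" for i xs
      using that by (simp add: P_def del: map_map)
    have "isomorphic L M N"
      unfolding isomorphic_def using bij_betw_trans[OF f g] hom
      by (intro exI[of _ "g \<circ> f"]) auto
    with not_iso show False ..
  qed
  with id P have "distinguishes \<phi> M P" unfolding identifies_def by (auto simp: P_def)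
  moreover have "true_on P \<phi> \<longleftrightarrow> true_on N \<phi>"
    using true_on_isomorphic[OF PN] id unfolding identifies_def by blast
  ultimately show ?thesis unfolding distinguishes_def by blast
qed

end

theory Submission
  imports Defs "HOL-Combinatorics.Transposition"
begin

text \<open>
  Spoiler plays the Ehrenfeucht game on \<open>M\<close> and a non-isomorphic \<open>N\<close> of the same order \<open>n\<close>. He first
  plays a set \<open>X\<close> in \<open>M\<close> and then stays in one of the two structures, so that a win in \<open>r\<close> rounds
  yields a distinguishing formula of quantifier rank \<open>r\<close> with at most one alternation.

  Two elements outside \<open>T\<close> are similar over \<open>T\<close> if exchanging them while fixing \<open>T\<close> is a partial
  isomorphism. If \<open>X\<close> has been played, Duplicator is forced to answer an element that is alone in its
  similarity class over \<open>X\<close> by a unique partner; any deviation can be exposed in a few further moves.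
  Iterating this \<open>k - 1\<close> times gives a set \<open>T \<supseteq> X\<close> of elements with forced answers, each iteration
  raising the price of exposing a deviation by \<open>k - 1\<close>.

  The set \<open>X\<close> is built in \<open>k - 1\<close> layers. In each layer one adds sets of at most \<open>k - 1\<close> elements as long
  as this raises the number of similarity classes (singleton classes counting twice), and then freezes
  the singleton classes. A tuple of at most \<open>k\<close> elements misses the frozen singletons of some layer, and
  maximality of that layer then shows that similar elements over \<open>T\<close> are interchangeable in \<open>M\<close>. Hence
  either the sizes of the similarity classes over \<open>T\<close> differ in \<open>M\<close> and \<open>N\<close>, and Spoiler wins by
  overfilling a class with at most about half of the elements outside \<open>T\<close>, or the sizes agree and he
  wins by playing in \<open>N\<close> a tuple that violates some class-preserving bijection.
\<close>

section \<open>Partial isomorphisms\<close>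

definition eq_clash :: "'a \<times> 'b \<Rightarrow> 'a \<times> 'b \<Rightarrow> bool" where
  "eq_clash p q \<longleftrightarrow> (fst p = fst q) \<noteq> (snd p = snd q)"

text \<open>A set of pairs is conflict-free iff it is (the graph of) a partial isomorphism.\<close>

definition conflict :: "vocabulary \<Rightarrow> 'a struct \<Rightarrow> 'b struct \<Rightarrow> ('a \<times> 'b) set \<Rightarrow> bool" where
  "conflict L M N P \<longleftrightarrow> (\<exists>p\<in>P. \<exists>q\<in>P. eq_clash p q) \<or>
     (\<exists>i<length L. \<exists>zs. length zs = L ! i \<and> set zs \<subseteq> P \<and>
        rel M i (map fst zs) \<noteq> rel N i (map snd zs))"

lemma conflict_mono: "conflict L M N P \<Longrightarrow> P \<subseteq> Q \<Longrightarrow> conflict L M N Q"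
  unfolding conflict_def by (meson subset_eq)

lemma conflict_converse [simp]: "conflict L N M (P\<inverse>) \<longleftrightarrow> conflict L M N P"
proof -
  have *: "conflict L N M (P\<inverse>)" if "conflict L M N P" for M :: "'x struct" and N :: "'y struct" and P
    using that unfolding conflict_def
  proof (elim disjE exE conjE)
    assume "\<exists>p\<in>P. \<exists>q\<in>P. eq_clash p q"
    then obtain x y x' y' where "(x, y) \<in> P" "(x', y') \<in> P" "eq_clash (x, y) (x', y')" by force
    then have "(y, x) \<in> P\<inverse>" "(y', x') \<in> P\<inverse>" "eq_clash (y, x) (y', x')"
      by (auto simp: eq_clash_def)
    then have "\<exists>p\<in>P\<inverse>. \<exists>q\<in>P\<inverse>. eq_clash p q" by blast
    then show "(\<exists>p\<in>P\<inverse>. \<exists>q\<in>P\<inverse>. eq_clash p q) \<or> (\<exists>i<length L. \<exists>zs. length zs = L ! i \<and>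
      set zs \<subseteq> P\<inverse> \<and> rel N i (map fst zs) \<noteq> rel M i (map snd zs))" ..
  next
    fix i zs assume i: "i < length L" "length zs = L ! i" "set zs \<subseteq> P"
      "rel M i (map fst zs) \<noteq> rel N i (map snd zs)"
    let ?zs = "map prod.swap zs"
    have "length ?zs = L ! i" "set ?zs \<subseteq> P\<inverse>" "rel N i (map fst ?zs) \<noteq> rel M i (map snd ?zs)"
      using i by (auto simp: comp_def)
    with i(1) show "(\<exists>p\<in>P\<inverse>. \<exists>q\<in>P\<inverse>. eq_clash p q) \<or> (\<exists>i<length L. \<exists>zs. length zs = L ! i \<and>
      set zs \<subseteq> P\<inverse> \<and> rel N i (map fst zs) \<noteq> rel M i (map snd zs))" by blast
  qed
  from *[of M N P] *[of N M "P\<inverse>"] show ?thesis by auto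
qed

text \<open>Partial isomorphisms compose. In this contrapositive form the lemma yields transitivity
  of similarity and the comparison of elements with a common partner.\<close>

lemma conflict_relcomp:
  assumes "conflict L M K (P O Q)" "\<not> conflict L M N P"
  shows "conflict L N K Q"
proof (rule ccontr)
  assume Q: "\<not> conflict L N K Q"
  from assms(1) consider p q where "p \<in> P O Q" "q \<in> P O Q" "eq_clash p q"
    | i zs where "i < length L" "length zs = L ! i" "set zs \<subseteq> P O Q"
      "rel M i (map fst zs) \<noteq> rel K i (map snd zs)"
    unfolding conflict_def by blast
  then show False
  proof cases
    case 1
    from 1(1) obtain x y z where p: "p = (x, z)" "(x, y) \<in> P" "(y, z) \<in> Q" by (elim relcompE)
    from 1(2) obtain x' y' z' where q: "q = (x', z')" "(x', y') \<in> P" "(y', z') \<in> Q"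
      by (elim relcompE)
    have "\<not> eq_clash (x, y) (x', y')" "\<not> eq_clash (y, z) (y', z')"
      using Q assms(2) p q unfolding conflict_def by blast+
    then show False using 1(3) p(1) q(1) by (simp add: eq_clash_def)
  next
    case 2
    \<comment> \<open>One middle element is fixed per entry, so that both factors speak about the
      same tuple of \<open>N\<close>.\<close>
    from 2(3) have "\<forall>z\<in>set zs. \<exists>y. (fst z, y) \<in> P \<and> (y, snd z) \<in> Q" by fastforce
    then obtain y where y: "\<And>z. z \<in> set zs \<Longrightarrow> (fst z, y z) \<in> P \<and> (y z, snd z) \<in> Q" by metis
    let ?ps = "map (\<lambda>z. (fst z, y z)) zs" and ?qs = "map (\<lambda>z. (y z, snd z)) zs"
    have "set ?ps \<subseteq> P" "set ?qs \<subseteq> Q" "length ?ps = L ! i" "length ?qs = L ! i"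
      using y 2(2) by auto
    then have "rel M i (map fst ?ps) = rel N i (map snd ?ps)"
      "rel N i (map fst ?qs) = rel K i (map snd ?qs)"
      using Q assms(2) 2(1) unfolding conflict_def by blast+
    with 2(4) show False by (simp add: comp_def)
  qed
qed

lemma not_conflict_Id_on: "\<not> conflict L M M (Id_on T)"
proof -
  have "map fst zs = map snd zs" if "set zs \<subseteq> Id_on T" for zs :: "('a \<times> 'a) list"
    using that by (induction zs) auto
  then have "rel M i (map fst zs) = rel M i (map snd zs)"
    if "set zs \<subseteq> Id_on T" for i and zs :: "('a \<times> 'a) list"
    using that by metis
  moreover have "\<not> eq_clash p q" if "p \<in> Id_on T" "q \<in> Id_on T" for p q
    using that by (auto simp: eq_clash_def)
  ultimately show ?thesis unfolding conflict_def by blast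
qed

lemma not_conflict_relD:
  assumes "\<not> conflict L M N P" "i < length L" "length xs = L ! i"
    and "\<And>x. x \<in> set xs \<Longrightarrow> (f x, h x) \<in> P"
  shows "rel M i (map f xs) \<longleftrightarrow> rel N i (map h xs)"
proof -
  let ?zs = "map (\<lambda>x. (f x, h x)) xs"
  have "length ?zs = L ! i" "set ?zs \<subseteq> P" using assms by auto
  then have "rel M i (map fst ?zs) \<longleftrightarrow> rel N i (map snd ?zs)"
    using assms(1,2) unfolding conflict_def by blast
  then show ?thesis by (simp add: comp_def)
qed

section \<open>The game and its formulas\<close>

text \<open>Spoiler wins within \<open>r\<close> rounds from position \<open>P\<close>, moving in \<open>M\<close> only.\<close>

fun ewin :: "vocabulary \<Rightarrow> 'a struct \<Rightarrow> 'b struct \<Rightarrow> nat \<Rightarrow> ('a \<times> 'b) set \<Rightarrow> bool" where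
  "ewin L M N 0 P \<longleftrightarrow> conflict L M N P"
| "ewin L M N (Suc r) P \<longleftrightarrow> ewin L M N r P \<or>
     (\<exists>a\<in>univ M. \<forall>b\<in>univ N. ewin L M N r (insert (a, b) P))"

lemma ewin_mono_rounds: "ewin L M N r P \<Longrightarrow> r \<le> r' \<Longrightarrow> ewin L M N r' P"
  by (induction r' rule: nat_induct) (auto simp: le_Suc_eq)

lemma ewin_mono: "ewin L M N r P \<Longrightarrow> P \<subseteq> Q \<Longrightarrow> ewin L M N r Q"
proof (induction r arbitrary: P Q)
  case 0
  then show ?case using conflict_mono by (metis ewin.simps(1))
next
  case (Suc r)
  then show ?case unfolding ewin.simps by (meson insert_mono)
qed

lemma conflict_ewin: "conflict L M N P \<Longrightarrow> ewin L M N r P"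
  using ewin_mono_rounds[of L M N 0 P r] by simp

text \<open>Spoiler can announce \<open>F\<close> in advance and play it in any order. The replies
  form one function \<open>\<rho>\<close>, and only the position after all of them matters.\<close>

lemma ewin_play:
  assumes "finite F" "F \<subseteq> univ M"
    and "\<And>\<rho>. \<rho> ` F \<subseteq> univ N \<Longrightarrow> ewin L M N r (P \<union> (\<lambda>a. (a, \<rho> a)) ` F)"
  shows "ewin L M N (card F + r) P"
  using assms
proof (induction F arbitrary: P)
  case empty
  then show ?case by simp
next
  case (insert a F)
  have "ewin L M N (card F + r) (insert (a, b) P)" if b: "b \<in> univ N" for b
  proof (rule insert.IH)
    show "F \<subseteq> univ M" using insert.prems by simp
    fix \<rho> assume "\<rho> ` F \<subseteq> univ N"
    then have "(\<rho>(a := b)) ` insert a F \<subseteq> univ N" using b insert.hyps by auto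
    from insert.prems(2)[OF this]
    show "ewin L M N r (insert (a, b) P \<union> (\<lambda>a. (a, \<rho> a)) ` F)"
      by (rule ewin_mono) (use insert.hyps in auto)
  qed
  moreover have "a \<in> univ M" using insert.prems by simp
  ultimately have "ewin L M N (Suc (card F + r)) P" by auto
  then show ?case using insert.hyps by simp
qed

text \<open>Spoiler makes \<open>s\<close> moves in \<open>M\<close> and then commits to one
  structure for the last \<open>r\<close> rounds. His choice may depend on the replies, so the
  subformulas may end in different quantifiers, while every single word has at most one
  alternation.\<close>

fun eawin :: "vocabulary \<Rightarrow> 'a struct \<Rightarrow> 'b struct \<Rightarrow> nat \<Rightarrow> nat \<Rightarrow> ('a \<times> 'b) set \<Rightarrow> bool" where
  "eawin L M N 0 r P \<longleftrightarrow> ewin L M N r P \<or> ewin L N M r (P\<inverse>)"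
| "eawin L M N (Suc s) r P \<longleftrightarrow> (\<exists>a\<in>univ M. \<forall>b\<in>univ N. eawin L M N s r (insert (a, b) P))"

lemma eawin_mono: "eawin L M N s r P \<Longrightarrow> P \<subseteq> Q \<Longrightarrow> eawin L M N s r Q"
proof (induction s arbitrary: P Q)
  case 0
  then show ?case using ewin_mono by (metis converse_mono eawin.simps(1))
next
  case (Suc s)
  then show ?case by (metis eawin.simps(2) insert_mono)
qed

lemma eawin_play:
  assumes "finite F" "F \<subseteq> univ M"
    and "\<And>\<rho>. \<rho> ` F \<subseteq> univ N \<Longrightarrow> eawin L M N 0 r (P \<union> (\<lambda>a. (a, \<rho> a)) ` F)"
  shows "eawin L M N (card F) r P"
  using assms
proof (induction F arbitrary: P)
  case empty
  then show ?case by simp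
next
  case (insert a F)
  have "eawin L M N (card F) r (insert (a, b) P)" if b: "b \<in> univ N" for b
  proof (rule insert.IH)
    show "F \<subseteq> univ M" using insert.prems by simp
    fix \<rho> assume "\<rho> ` F \<subseteq> univ N"
    then have "(\<rho>(a := b)) ` insert a F \<subseteq> univ N" using b insert.hyps by auto
    from insert.prems(2)[OF this]
    show "eawin L M N 0 r (insert (a, b) P \<union> (\<lambda>a. (a, \<rho> a)) ` F)"
      by (rule eawin_mono) (use insert.hyps in auto)
  qed
  moreover have "a \<in> univ M" using insert.prems by simp
  ultimately have "eawin L M N (Suc (card F)) r P" by auto
  then show ?case using insert.hyps by simp
qed

section \<open>Turning winning strategies into formulas\<close>

lemma ex_conj_formula:
  assumes "finite S" and "K \<psi>" "sat M \<sigma> \<psi>" and "\<And>\<phi> \<psi>. K \<phi> \<Longrightarrow> K \<psi> \<Longrightarrow> K (Conj \<phi> \<psi>)"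
    and "\<And>b. b \<in> S \<Longrightarrow> \<exists>\<phi>. K \<phi> \<and> sat M \<sigma> \<phi> \<and> \<not> sat (N b) (\<tau> b) \<phi>"
  shows "\<exists>\<phi>. K \<phi> \<and> sat M \<sigma> \<phi> \<and> (\<forall>b\<in>S. \<not> sat (N b) (\<tau> b) \<phi>)"
  using assms(1,5)
proof (induction S)
  case empty
  \<comment> \<open>With nothing to exclude, \<open>\<psi>\<close> stands in for the empty
    conjunction.\<close>
  then show ?case using assms(2,3) by auto
next
  case (insert b S)
  then obtain \<phi>1 \<phi>2 where "K \<phi>1 \<and> sat M \<sigma> \<phi>1 \<and> (\<forall>b\<in>S. \<not> sat (N b) (\<tau> b) \<phi>1)"
    "K \<phi>2 \<and> sat M \<sigma> \<phi>2 \<and> \<not> sat (N b) (\<tau> b) \<phi>2" by (meson insertCI)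
  then show ?case using assms(4) by (intro exI[of _ "Conj \<phi>1 \<phi>2"]) auto
qed

text \<open>Variable \<open>i\<close> names the \<open>i\<close>-th pair of the position. A conflict
  is witnessed by one atomic formula, possibly negated, and negation preserves the nest
  \<open>{[]}\<close>.\<close>

lemma conflict_formula:
  assumes "conflict L M N ((\<lambda>i. (\<sigma> i, \<tau> i)) ` {..<m})"
  shows "\<exists>\<phi>. formula L \<phi> \<and> fv \<phi> \<subseteq> {..<m} \<and> nest \<phi> = {[]} \<and> sat M \<sigma> \<phi> \<and> \<not> sat N \<tau> \<phi>"
proof -
  have *: ?thesis if "formula L \<phi>" "fv \<phi> \<subseteq> {..<m}" "nest \<phi> = {[]}" "sat M \<sigma> \<phi> \<noteq> sat N \<tau> \<phi>" for \<phi>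
  proof (cases "sat M \<sigma> \<phi>")
    case True
    then show ?thesis using that by auto
  next
    case False
    then show ?thesis using that by (intro exI[of _ "Neg \<phi>"]) auto
  qed
  from assms consider p q where "p < m" "q < m" "eq_clash (\<sigma> p, \<tau> p) (\<sigma> q, \<tau> q)"
    | i zs where "i < length L" "length zs = L ! i" "set zs \<subseteq> (\<lambda>i. (\<sigma> i, \<tau> i)) ` {..<m}"
      "rel M i (map fst zs) \<noteq> rel N i (map snd zs)"
    unfolding conflict_def by auto
  then show ?thesis
  proof cases
    case 1
    then show ?thesis by (intro *[of "Eq p q"]) (auto simp: eq_clash_def)
  next
    case 2
    from 2(3) have "\<forall>z\<in>set zs. \<exists>j<m. z = (\<sigma> j, \<tau> j)" by auto
    then obtain j where j: "\<And>z. z \<in> set zs \<Longrightarrow> j z < m \<and> z = (\<sigma> (j z), \<tau> (j z))" by metis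
    then have "map (\<sigma> \<circ> j) zs = map fst zs" "map (\<tau> \<circ> j) zs = map snd zs"
      by (auto intro!: map_cong)
    then have "sat M \<sigma> (Rel i (map j zs)) \<noteq> sat N \<tau> (Rel i (map j zs))" using 2(4)
      by (simp only: sat.simps map_map not_False_eq_True)
    moreover have "formula L (Rel i (map j zs))" "fv (Rel i (map j zs)) \<subseteq> {..<m}"
      "nest (Rel i (map j zs)) = {[]}" using 2(1,2) j by auto
    ultimately show ?thesis by (intro *)
  qed
qed

text \<open>The move \<open>a\<close> becomes the quantifier \<open>Exi m\<close>; below it stands
  the conjunction of the formulas that refute the individual replies \<open>b\<close>, which is
  finite because \<open>N\<close> is.\<close>

lemma move_formula:
  fixes M :: "'a struct" and N :: "'b struct"
  assumes "finite (univ N)" "a \<in> univ M" "[] \<in> U"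
    and "\<And>b. b \<in> univ N \<Longrightarrow> \<exists>\<phi>. formula L \<phi> \<and> fv \<phi> \<subseteq> {..<Suc m} \<and> nest \<phi> \<subseteq> U \<and>
      sat M (\<sigma>(m := a)) \<phi> \<and> \<not> sat N (\<tau>(m := b)) \<phi>"
  shows "\<exists>\<phi>. formula L \<phi> \<and> fv \<phi> \<subseteq> {..<m} \<and> nest \<phi> \<subseteq> Cons Ex_q ` U \<and> sat M \<sigma> \<phi> \<and> \<not> sat N \<tau> \<phi>"
proof -
  let ?K = "\<lambda>\<phi>. formula L \<phi> \<and> fv \<phi> \<subseteq> {..<Suc m} \<and> nest \<phi> \<subseteq> U"
  \<comment> \<open>The filler \<open>Eq m m\<close> covers an empty universe of \<open>N\<close>;
    its nest is why \<open>U\<close> has to contain the empty word.\<close>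
  have "\<exists>\<phi>. ?K \<phi> \<and> sat M (\<sigma>(m := a)) \<phi> \<and> (\<forall>b\<in>univ N. \<not> sat N (\<tau>(m := b)) \<phi>)"
    using assms by (intro ex_conj_formula[where \<psi> = "Eq m m"]) auto
  then obtain \<phi> where "?K \<phi>" "sat M (\<sigma>(m := a)) \<phi>" "\<forall>b\<in>univ N. \<not> sat N (\<tau>(m := b)) \<phi>" by blast
  then show ?thesis using assms(2) by (intro exI[of _ "Exi m \<phi>"]) (auto simp: lessThan_Suc)
qed

lemma image_pair_upd:
  "(\<lambda>i. ((\<sigma>(m := a)) i, (\<tau>(m := b)) i)) ` {..<Suc m} = insert (a, b) ((\<lambda>i. (\<sigma> i, \<tau> i)) ` {..<m})"
  by (auto simp: lessThan_Suc image_iff)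

lemma ewin_formula:
  fixes M :: "'a struct" and N :: "'b struct"
  assumes "ewin L M N r ((\<lambda>i. (\<sigma> i, \<tau> i)) ` {..<m})" "finite (univ N)"
  shows "\<exists>\<phi>. formula L \<phi> \<and> fv \<phi> \<subseteq> {..<m} \<and> nest \<phi> \<subseteq> {replicate j Ex_q |j. j \<le> r} \<and>
    sat M \<sigma> \<phi> \<and> \<not> sat N \<tau> \<phi>"
  using assms(1)
proof (induction r arbitrary: \<sigma> \<tau> m)
  case 0
  then show ?case using conflict_formula[of L M N \<sigma> \<tau> m] by auto
next
  case (Suc r)
  let ?U = "\<lambda>r. {replicate j Ex_q |j. j \<le> r}"
  have U: "?U r \<subseteq> ?U (Suc r)" "Cons Ex_q ` ?U r \<subseteq> ?U (Suc r)"
  proof -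
    show "Cons Ex_q ` ?U r \<subseteq> ?U (Suc r)"
    proof
      fix w assume "w \<in> Cons Ex_q ` ?U r"
      then obtain j where "w = replicate (Suc j) Ex_q" "Suc j \<le> Suc r" by auto
      then show "w \<in> ?U (Suc r)" by blast
    qed
  qed (auto intro: le_SucI)
  from Suc.prems consider "ewin L M N r ((\<lambda>i. (\<sigma> i, \<tau> i)) ` {..<m})"
    | a where "a \<in> univ M"
      "\<And>b. b \<in> univ N \<Longrightarrow> ewin L M N r (insert (a, b) ((\<lambda>i. (\<sigma> i, \<tau> i)) ` {..<m}))"
    unfolding ewin.simps by blast
  then show ?case
  proof cases
    case 1
    from Suc.IH[OF this] U(1) show ?thesis by (meson subset_trans)
  next
    case 2
    have "\<exists>\<phi>. formula L \<phi> \<and> fv \<phi> \<subseteq> {..<m} \<and> nest \<phi> \<subseteq> Cons Ex_q ` ?U r \<and> sat M \<sigma> \<phi> \<and> \<not> sat N \<tau> \<phi>"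
    proof (rule move_formula[OF assms(2) 2(1)])
      fix b assume "b \<in> univ N"
      from 2(2)[OF this, folded image_pair_upd] show "\<exists>\<phi>. formula L \<phi> \<and> fv \<phi> \<subseteq> {..<Suc m} \<and>
        nest \<phi> \<subseteq> ?U r \<and> sat M (\<sigma>(m := a)) \<phi> \<and> \<not> sat N (\<tau>(m := b)) \<phi>" by (rule Suc.IH)
    qed auto
    with U(2) show ?thesis by (meson subset_trans)
  qed
qed

lemma eawin_formula:
  fixes M :: "'a struct" and N :: "'b struct"
  assumes "eawin L M N s r ((\<lambda>i. (\<sigma> i, \<tau> i)) ` {..<m})" "finite (univ M)" "finite (univ N)"
  shows "\<exists>\<phi>. formula L \<phi> \<and> fv \<phi> \<subseteq> {..<m} \<and>
    nest \<phi> \<subseteq> {replicate i Ex_q @ replicate j q |i j q. i \<le> s \<and> j \<le> r} \<and> sat M \<sigma> \<phi> \<and> \<not> sat N \<tau> \<phi>"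
  using assms(1)
proof (induction s arbitrary: \<sigma> \<tau> m)
  case 0
  let ?P = "(\<lambda>i. (\<sigma> i, \<tau> i)) ` {..<m}"
  from 0 consider "ewin L M N r ?P" | "ewin L N M r (?P\<inverse>)" unfolding eawin.simps by blast
  then show ?case
  proof cases
    case 1
    have "{replicate j Ex_q |j. j \<le> r} \<subseteq> {replicate i Ex_q @ replicate j q |i j q. i \<le> 0 \<and> j \<le> r}"
      by auto
    with ewin_formula[OF 1 assms(3)] show ?thesis by (meson subset_trans)
  next
    case 2
    have "?P\<inverse> = (\<lambda>i. (\<tau> i, \<sigma> i)) ` {..<m}" by auto
    from ewin_formula[OF 2[unfolded this] assms(2)] obtain \<phi> where \<phi>: "formula L \<phi>" "fv \<phi> \<subseteq> {..<m}"
      "nest \<phi> \<subseteq> {replicate j Ex_q |j. j \<le> r}" "sat N \<tau> \<phi>" "\<not> sat M \<sigma> \<phi>" by blast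
    \<comment> \<open>A win in \<open>N\<close> gives an existential formula true on
      \<open>N\<close> and false on \<open>M\<close>. Its negation distinguishes in the right
      direction, and its words consist of universal quantifiers.\<close>
    then have "nest (Neg \<phi>) \<subseteq> {replicate i Ex_q @ replicate j q |i j q. i \<le> 0 \<and> j \<le> r}"
      by auto
    with \<phi> show ?thesis by (intro exI[of _ "Neg \<phi>"]) auto
  qed
next
  case (Suc s)
  let ?U = "\<lambda>s. {replicate i Ex_q @ replicate j q |i j q. i \<le> s \<and> j \<le> r}"
  have U: "Cons Ex_q ` ?U s \<subseteq> ?U (Suc s)"
  proof
    fix w assume "w \<in> Cons Ex_q ` ?U s"
    then obtain i j q where "w = Ex_q # replicate i Ex_q @ replicate j q" "i \<le> s" "j \<le> r" by blast
    then have "w = replicate (Suc i) Ex_q @ replicate j q" "Suc i \<le> Suc s" "j \<le> r" by auto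
    then show "w \<in> ?U (Suc s)" by blast
  qed
  from Suc.prems obtain a where a: "a \<in> univ M"
    "\<And>b. b \<in> univ N \<Longrightarrow> eawin L M N s r (insert (a, b) ((\<lambda>i. (\<sigma> i, \<tau> i)) ` {..<m}))"
    unfolding eawin.simps by blast
  have "\<exists>\<phi>. formula L \<phi> \<and> fv \<phi> \<subseteq> {..<m} \<and> nest \<phi> \<subseteq> Cons Ex_q ` ?U s \<and> sat M \<sigma> \<phi> \<and> \<not> sat N \<tau> \<phi>"
  proof (rule move_formula[OF assms(3) a(1)])
    fix b assume "b \<in> univ N"
    from a(2)[OF this, folded image_pair_upd] show "\<exists>\<phi>. formula L \<phi> \<and> fv \<phi> \<subseteq> {..<Suc m} \<and>
      nest \<phi> \<subseteq> ?U s \<and> sat M (\<sigma>(m := a)) \<phi> \<and> \<not> sat N (\<tau>(m := b)) \<phi>" by (rule Suc.IH)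
  qed auto
  with U show ?case by (meson subset_trans)
qed

lemma alternations_two_blocks: "alternations (replicate i q @ replicate j q') \<le> 1"
proof -
  let ?w = "replicate i q @ replicate j q'"
  \<comment> \<open>The letter can change only at the last position of the first block.\<close>
  have "{l. Suc l < length ?w \<and> ?w ! l \<noteq> ?w ! Suc l} \<subseteq> {i - 1}"
  proof
    fix l assume l: "l \<in> {l. Suc l < length ?w \<and> ?w ! l \<noteq> ?w ! Suc l}"
    have "\<not> Suc l < i" "\<not> i \<le> l" using l by (auto simp: nth_append)
    then show "l \<in> {i - 1}" by auto
  qed
  from card_mono[OF _ this] show ?thesis unfolding alternations_def by simp
qed

lemma finite_nest: "finite (nest \<phi>)" and nest_nonempty: "nest \<phi> \<noteq> {}"
  by (induction \<phi>) auto

section \<open>Similarity over a set\<close>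

text \<open>Meant for \<open>u, v \<notin> T\<close>; for \<open>u \<in> T\<close> it degenerates to \<open>u = v\<close>.\<close>

definition similar :: "vocabulary \<Rightarrow> 'a struct \<Rightarrow> 'a set \<Rightarrow> 'a \<Rightarrow> 'a \<Rightarrow> bool" where
  "similar L M T u v \<longleftrightarrow> \<not> conflict L M M (insert (u, v) (Id_on T))"

lemma similar_sym: "similar L M T u v \<Longrightarrow> similar L M T v u"
proof -
  have "(insert (u, v) (Id_on T))\<inverse> = insert (v, u) (Id_on T)" by auto
  then show "similar L M T u v \<Longrightarrow> similar L M T v u"
    unfolding similar_def by (metis conflict_converse)
qed

lemma similar_trans: "similar L M T u v \<Longrightarrow> similar L M T v w \<Longrightarrow> similar L M T u w"
proof -
  have "insert (u, w) (Id_on T) \<subseteq> insert (u, v) (Id_on T) O insert (v, w) (Id_on T)" by auto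
  then show "similar L M T u v \<Longrightarrow> similar L M T v w \<Longrightarrow> similar L M T u w"
    unfolding similar_def by (meson conflict_mono conflict_relcomp)
qed

lemma similar_refl [simp]: "similar L M T u u"
proof -
  have "insert (u, u) (Id_on T) = Id_on (insert u T)" by auto
  then show ?thesis unfolding similar_def by (simp add: not_conflict_Id_on)
qed

lemma similar_antimono: "similar L M T' u v \<Longrightarrow> T \<subseteq> T' \<Longrightarrow> similar L M T u v"
proof -
  assume "T \<subseteq> T'"
  then have "insert (u, v) (Id_on T) \<subseteq> insert (u, v) (Id_on T')" by auto
  then show "similar L M T' u v \<Longrightarrow> similar L M T u v" unfolding similar_def using conflict_mono by blast
qed

text \<open>Both tuples are images of one tuple \<open>xs\<close>, so that \<open>u\<close> may turn
  into \<open>v\<close> at several places at once.\<close>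

lemma similar_relD:
  assumes "similar L M T u v" "i < length L" "length xs = L ! i"
    and "\<And>x. x \<in> set xs \<Longrightarrow> f x = u \<and> h x = v \<or> f x = h x \<and> f x \<in> T"
  shows "rel M i (map f xs) \<longleftrightarrow> rel M i (map h xs)"
  using assms(1) unfolding similar_def
proof (rule not_conflict_relD[OF _ assms(2,3)])
  fix x assume "x \<in> set xs"
  from assms(4)[OF this] show "(f x, h x) \<in> insert (u, v) (Id_on T)" by auto
qed

definition sim_class :: "vocabulary \<Rightarrow> 'a struct \<Rightarrow> 'a set \<Rightarrow> 'a \<Rightarrow> 'a set" where
  "sim_class L M T u = {v \<in> univ M - T. similar L M T u v}"

definition singles :: "vocabulary \<Rightarrow> 'a struct \<Rightarrow> 'a set \<Rightarrow> 'a set" where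
  "singles L M T = {u \<in> univ M - T. sim_class L M T u = {u}}"

definition num_classes :: "vocabulary \<Rightarrow> 'a struct \<Rightarrow> 'a set \<Rightarrow> nat" where
  "num_classes L M T = card (sim_class L M T ` (univ M - T))"

lemma sim_class_eq_iff:
  "u \<in> univ M - T \<Longrightarrow> v \<in> univ M - T \<Longrightarrow> sim_class L M T u = sim_class L M T v \<longleftrightarrow> similar L M T u v"
proof -
  assume u: "u \<in> univ M - T" and v: "v \<in> univ M - T"
  have "similar L M T u w \<longleftrightarrow> similar L M T v w" if "similar L M T u v" for w
    using that similar_sym similar_trans by metis
  moreover have "v \<in> sim_class L M T v" using v by (simp add: sim_class_def similar_refl)
  ultimately show "sim_class L M T u = sim_class L M T v \<longleftrightarrow> similar L M T u v"
    unfolding sim_class_def by blast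
qed

lemma singlesD: "u \<in> singles L M T \<Longrightarrow> v \<in> univ M - T \<Longrightarrow> similar L M T u v \<Longrightarrow> v = u"
  unfolding singles_def sim_class_def by blast

lemma singlesI:
  "u \<in> univ M - T \<Longrightarrow> (\<And>v. v \<in> univ M - T \<Longrightarrow> similar L M T u v \<Longrightarrow> v = u) \<Longrightarrow> u \<in> singles L M T"
  unfolding singles_def sim_class_def by auto

lemma singles_subset: "singles L M T \<subseteq> univ M - T"
  unfolding singles_def by blast

text \<open>Enlarging the set only separates elements, so a singleton class survives until its
  element is absorbed.\<close>

lemma singles_mono: "T \<subseteq> T' \<Longrightarrow> u \<in> singles L M T \<Longrightarrow> u \<notin> T' \<Longrightarrow> u \<in> singles L M T'"
  using singlesD[of u L M T] singles_subset[of L M T]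
  by (intro singlesI) (auto dest: similar_antimono[where T = T])

text \<open>Here \<open>g x\<close> determines \<open>f x\<close>, which induces a map from the
  values of \<open>g\<close> onto those of \<open>f\<close>. If \<open>g\<close> separates a pair
  that \<open>f\<close> identifies, this map is not injective, whence the strict inequality.\<close>

lemma card_image_le_refine:
  assumes "finite D" and "\<And>x y. x \<in> D \<Longrightarrow> y \<in> D \<Longrightarrow> g x = g y \<Longrightarrow> f x = f y"
  shows "card (f ` D) \<le> card (g ` D)"
    and "a \<in> D \<Longrightarrow> b \<in> D \<Longrightarrow> f a = f b \<Longrightarrow> g a \<noteq> g b \<Longrightarrow> card (f ` D) < card (g ` D)"
proof -
  define h where "h = (\<lambda>c. f (SOME x. x \<in> D \<and> g x = c))"
  have h: "h (g x) = f x" if "x \<in> D" for x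
  proof -
    have "(SOME y. y \<in> D \<and> g y = g x) \<in> D \<and> g (SOME y. y \<in> D \<and> g y = g x) = g x"
      using that by (intro someI[of "\<lambda>y. y \<in> D \<and> g y = g x"]) simp
    then show ?thesis unfolding h_def using assms(2) that by blast
  qed
  then have im: "f ` D = h ` g ` D" by (force simp: image_image)
  show le: "card (f ` D) \<le> card (g ` D)" unfolding im using assms(1) by (simp add: card_image_le)
  show "card (f ` D) < card (g ` D)" if "a \<in> D" "b \<in> D" "f a = f b" "g a \<noteq> g b"
  proof -
    have "\<not> inj_on h (g ` D)" using that h unfolding inj_on_def by (metis imageI)
    then have "card (h ` g ` D) \<noteq> card (g ` D)" using assms(1) eq_card_imp_inj_on by blast
    with le im show ?thesis by simp
  qed
qed

section \<open>Local maxima of the potential\<close>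

locale finite_structure =
  fixes L :: vocabulary and M :: "'a struct" and k :: nat
  assumes finite_univ: "finite (univ M)" and k_pos: "0 < k"
    and arity_le: "i < length L \<Longrightarrow> L ! i \<le> k"
begin

abbreviation "V \<equiv> univ M"
abbreviation "sim \<equiv> similar L M"
abbreviation "sg \<equiv> singles L M"

text \<open>Counting singleton classes twice makes it profitable to break up every class with between
  \<open>2\<close> and \<open>k\<close> elements.\<close>

definition potential :: "'a set \<Rightarrow> nat" where
  "potential B = num_classes L M B + card (sg B)"

lemma finite_singles [simp]: "finite (sg B)"
  using finite_univ singles_subset[of L M B] by (meson finite_Diff finite_subset)

text \<open>Every class over \<open>B\<close> has a representative outside \<open>B'\<close>, so
  both partitions can be counted on \<open>V - B'\<close>, where the one over \<open>B'\<close>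
  refines the one over \<open>B\<close>.\<close>

lemma num_classes_refine:
  assumes "B \<subseteq> B'" and "\<And>u. u \<in> V - B \<Longrightarrow> \<exists>u'\<in>V - B'. sim B u u'"
  shows "num_classes L M B \<le> num_classes L M B'"
    and "a \<in> V - B' \<Longrightarrow> b \<in> V - B' \<Longrightarrow> sim B a b \<Longrightarrow> \<not> sim B' a b \<Longrightarrow>
      num_classes L M B < num_classes L M B'"
proof -
  have im: "sim_class L M B ` (V - B) = sim_class L M B ` (V - B')"
  proof
    show "sim_class L M B ` (V - B) \<subseteq> sim_class L M B ` (V - B')"
    proof (rule image_subsetI)
      fix u assume u: "u \<in> V - B"
      then obtain u' where "u' \<in> V - B'" "sim B u u'" using assms(2) by blast
      moreover have "sim_class L M B u = sim_class L M B u'"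
        using calculation u assms(1) by (subst sim_class_eq_iff) auto
      ultimately show "sim_class L M B u \<in> sim_class L M B ` (V - B')" by blast
    qed
  qed (use assms(1) in auto)
  have fin: "finite (V - B')" using finite_univ by simp
  have ref: "sim_class L M B x = sim_class L M B y"
    if "x \<in> V - B'" "y \<in> V - B'" "sim_class L M B' x = sim_class L M B' y" for x y
  proof -
    have "sim B' x y" using that by (simp add: sim_class_eq_iff)
    then have "sim B x y" using assms(1) by (rule similar_antimono)
    then show ?thesis using that assms(1) by (subst sim_class_eq_iff) auto
  qed
  show "num_classes L M B \<le> num_classes L M B'" unfolding num_classes_def im
    by (rule card_image_le_refine(1)[OF fin ref])
  show "num_classes L M B < num_classes L M B'"
    if "a \<in> V - B'" "b \<in> V - B'" "sim B a b" "\<not> sim B' a b"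
    unfolding num_classes_def im
  proof (rule card_image_le_refine(2)[OF fin ref that(1,2)])
    show "sim_class L M B a = sim_class L M B b" using that assms(1) by (subst sim_class_eq_iff) auto
    show "sim_class L M B' a \<noteq> sim_class L M B' b" using that by (simp add: sim_class_eq_iff)
  qed
qed

text \<open>The bound \<open>k - 1\<close> is the number of entries that a tuple of length
  \<open>k\<close> can have besides the one to be replaced.\<close>

definition maximal :: "'a set \<Rightarrow> bool" where
  "maximal B \<longleftrightarrow> (\<forall>Y. Y \<subseteq> V - B \<longrightarrow> card Y \<le> k - 1 \<longrightarrow> potential (B \<union> Y) \<le> potential B)"

text \<open>Otherwise one could absorb the whole class except \<open>u\<close>. The element
  \<open>u\<close> still represents it, so the number of classes does not drop, and \<open>u\<close>
  becomes an additional singleton.\<close>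

lemma maximal_large_class:
  assumes "maximal B" "u \<in> V - B" "u \<notin> sg B"
  shows "k < card (sim_class L M B u)"
proof (rule ccontr)
  assume small: "\<not> k < card (sim_class L M B u)"
  let ?Y = "sim_class L M B u - {u}"
  have u: "u \<in> sim_class L M B u" using assms(2) by (auto simp: sim_class_def)
  have fin: "finite (sim_class L M B u)" unfolding sim_class_def using finite_univ by simp
  have Y: "?Y \<subseteq> V - B" "card ?Y \<le> k - 1"
    using small u fin by (fastforce simp: sim_class_def, simp)
  have "num_classes L M B \<le> num_classes L M (B \<union> ?Y)"
  proof (rule num_classes_refine(1))
    fix x assume x: "x \<in> V - B"
    show "\<exists>u'\<in>V - (B \<union> ?Y). sim B x u'"
    proof (cases "x \<in> ?Y")
      case True
      then have "sim B x u" by (auto simp: sim_class_def intro: similar_sym)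
      then show ?thesis using assms(2) by (intro bexI[of _ u]) auto
    next
      case False
      then show ?thesis using x by (intro bexI[of _ x] similar_refl) simp
    qed
  qed simp
  moreover have "insert u (sg B) \<subseteq> sg (B \<union> ?Y)"
  proof -
    have "x \<in> sg (B \<union> ?Y)" if x: "x \<in> sg B" for x
    proof (rule singles_mono[OF _ x])
      have "x \<notin> ?Y"
      proof
        assume "x \<in> ?Y"
        then have "sim B x u" "x \<noteq> u" by (auto simp: sim_class_def intro: similar_sym)
        with x assms(2) show False using singlesD by metis
      qed
      moreover have "x \<notin> B" using x singles_subset[of L M B] by blast
      ultimately show "x \<notin> B \<union> ?Y" by blast
    qed simp
    moreover have "u \<in> sg (B \<union> ?Y)"
    proof (rule singlesI)
      show "u \<in> V - (B \<union> ?Y)" using assms(2) by simp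
      fix v assume v: "v \<in> V - (B \<union> ?Y)" "sim (B \<union> ?Y) u v"
      then have "sim B u v" by (auto elim: similar_antimono)
      with v show "v = u" by (auto simp: sim_class_def)
    qed
    ultimately show ?thesis by blast
  qed
  then have "card (insert u (sg B)) \<le> card (sg (B \<union> ?Y))" by (intro card_mono) auto
  then have "Suc (card (sg B)) \<le> card (sg (B \<union> ?Y))" using assms(3) by simp
  ultimately have "potential B < potential (B \<union> ?Y)" unfolding potential_def by linarith
  with assms(1) Y show False unfolding maximal_def by (meson not_le)
qed

text \<open>Absorbing \<open>Y\<close> destroys no class: \<open>Y\<close> avoids the singletons,
  and every other class has more than \<open>k\<close> elements. Hence separating \<open>a\<close>
  from \<open>b\<close> would raise the potential.\<close>

lemma maximal_no_split:
  assumes "maximal B" "Y \<subseteq> V - B - sg B" "card Y \<le> k - 1"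
    and "a \<in> V - (B \<union> Y)" "b \<in> V - (B \<union> Y)" "sim B a b"
  shows "sim (B \<union> Y) a b"
proof (rule ccontr)
  assume "\<not> sim (B \<union> Y) a b"
  have finY: "finite Y" using assms(2) finite_univ by (meson finite_Diff finite_subset)
  have "num_classes L M B < num_classes L M (B \<union> Y)"
  proof (rule num_classes_refine(2)[OF _ _ assms(4-6)])
    fix u assume u: "u \<in> V - B"
    show "\<exists>u'\<in>V - (B \<union> Y). sim B u u'"
    proof (cases "u \<in> sg B")
      case True
      then have "u \<notin> Y" using assms(2) by blast
      then show ?thesis using u by (intro bexI[of _ u] similar_refl) simp
    next
      case False
      from maximal_large_class[OF assms(1) u this] assms(3) have "\<not> sim_class L M B u \<subseteq> Y"
        using card_mono[OF finY, of "sim_class L M B u"] by linarith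
      then show ?thesis unfolding sim_class_def by blast
    qed
  qed (use \<open>\<not> sim (B \<union> Y) a b\<close> in auto)
  moreover have "sg B \<subseteq> sg (B \<union> Y)"
  proof
    fix x assume x: "x \<in> sg B"
    then have "x \<notin> B \<union> Y" using assms(2) singles_subset[of L M B] by blast
    then show "x \<in> sg (B \<union> Y)" by (intro singles_mono[OF _ x]) simp
  qed
  then have "card (sg B) \<le> card (sg (B \<union> Y))" by (intro card_mono) auto
  ultimately have "potential B < potential (B \<union> Y)" unfolding potential_def by linarith
  moreover have "Y \<subseteq> V - B" using assms(2) by blast
  ultimately show False using assms(1,3) unfolding maximal_def by (meson not_le)
qed

section \<open>Layered bases\<close>

text \<open>Pigeonhole: otherwise the disjoint sets would have \<open>r\<close> distinct
  representatives in \<open>D\<close>.\<close>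

lemma ex_disjoint_from:
  fixes S :: "nat \<Rightarrow> 'b set"
  assumes "finite D" "card D < r"
    and "\<And>i j. i < r \<Longrightarrow> j < r \<Longrightarrow> i \<noteq> j \<Longrightarrow> S i \<inter> S j = {}"
  shows "\<exists>i<r. S i \<inter> D = {}"
proof (rule ccontr)
  assume "\<not> (\<exists>i<r. S i \<inter> D = {})"
  then have "\<forall>i\<in>{..<r}. \<exists>x. x \<in> S i \<inter> D" by blast
  then obtain x where x: "\<And>i. i < r \<Longrightarrow> x i \<in> S i \<inter> D" by (metis lessThan_iff)
  have "inj_on x {..<r}"
  proof (rule inj_onI, rule ccontr)
    fix i j assume "i \<in> {..<r}" "j \<in> {..<r}" "x i = x j" "i \<noteq> j"
    then show False using x[of i] x[of j] assms(3)[of i j] by auto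
  qed
  then have "r \<le> card D"
    using card_inj_on_le[of x "{..<r}" D] x assms(1) by auto
  with assms(2) show False by simp
qed

text \<open>If \<open>T\<close> does not already contain the other entries, the tuple is too short
  to meet the singletons of all layers. Over a layer that it misses, \<open>maximal_no_split\<close>
  keeps similar elements similar even when the other entries are fixed.\<close>

lemma layers_transpose_preserves:
  assumes B: "\<And>i. i < k - 1 \<Longrightarrow> maximal (B i) \<and> B i \<union> sg (B i) \<subseteq> T"
    and disj: "\<And>i j. i < k - 1 \<Longrightarrow> j < k - 1 \<Longrightarrow> i \<noteq> j \<Longrightarrow> sg (B i) \<inter> sg (B j) = {}"
    and uv: "u \<in> V - T" "v \<in> V - T" "sim T u v"
    and xs: "i < length L" "length xs = L ! i" "set xs \<subseteq> V"
  shows "rel M i (map (transpose u v) xs) \<longleftrightarrow> rel M i xs"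
proof -
  have len: "length xs \<le> k" using xs arity_le by simp
  have one: "rel M i (map (transpose u v) xs) \<longleftrightarrow> rel M i xs"
    if uv: "u \<in> V - T" "v \<in> V - T" "sim T u v" and u: "u \<in> set xs" and v: "v \<notin> set xs"
      and xs: "length xs = L ! i" "set xs \<subseteq> V" for u v xs
  proof -
    let ?D = "set xs - {u}"
    have len: "length xs \<le> k" using \<open>i < length L\<close> xs arity_le by simp
    have D: "card ?D \<le> k - 1" using card_length[of xs] len u by simp
    have "\<exists>C. sim C u v \<and> ?D \<subseteq> C"
    proof (cases "?D \<subseteq> T")
      case True
      then show ?thesis using uv by blast
    next
      case False
      \<comment> \<open>An entry outside \<open>T\<close> leaves fewer than \<open>k - 1\<close>
        entries inside \<open>T\<close>. As the singletons of all layers lie in \<open>T\<close>,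
        all of \<open>?D\<close> misses those of some layer.\<close>
      then obtain z where z: "z \<in> ?D" "z \<notin> T" by blast
      then have "card (?D \<inter> T) < card ?D" by (intro psubset_card_mono) auto
      then have "card (?D \<inter> T) < k - 1" using D by linarith
      then obtain j where j: "j < k - 1" "sg (B j) \<inter> (?D \<inter> T) = {}"
        using ex_disjoint_from[of "?D \<inter> T" "k - 1" "\<lambda>i. sg (B i)"] disj by auto
      then have sj: "sg (B j) \<inter> ?D = {}" using B[OF j(1)] by blast
      let ?Y = "?D - B j"
      have "sim (B j \<union> ?Y) u v"
      proof (rule maximal_no_split)
        show "maximal (B j)" using B j by blast
        show "?Y \<subseteq> V - B j - sg (B j)" using sj xs by auto
        have "card ?Y \<le> card ?D" by (intro card_mono) auto
        then show "card ?Y \<le> k - 1" using D by linarith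
        show "u \<in> V - (B j \<union> ?Y)" "v \<in> V - (B j \<union> ?Y)" using uv v B[OF j(1)] by auto
        show "sim (B j) u v" using similar_antimono[OF uv(3)] B[OF j(1)] by blast
      qed
      then show ?thesis by blast
    qed
    then obtain C where "sim C u v" "?D \<subseteq> C" by blast
    then have "rel M i (map id xs) \<longleftrightarrow> rel M i (map (transpose u v) xs)"
      using v by (intro similar_relD[OF _ \<open>i < length L\<close> xs(1), where T = C and u = u and v = v])
        (auto simp: transpose_def)
    then show ?thesis by simp
  qed
  consider "u \<notin> set xs" "v \<notin> set xs" | "u \<in> set xs" "v \<notin> set xs" | "u \<notin> set xs" "v \<in> set xs"
    | "u \<in> set xs" "v \<in> set xs" by blast
  then show ?thesis
  proof cases
    case 1
    then have "map (transpose u v) xs = xs" by (intro map_idI) (auto simp: transpose_def)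
    then show ?thesis by simp
  next
    case 2
    then show ?thesis using one[OF uv] xs by blast
  next
    case 3
    then show ?thesis using one[OF uv(2,1) similar_sym[OF uv(3)]] xs by (metis transpose_commute)
  next
    case 4
    show ?thesis
    proof (cases "u = v")
      case True
      then show ?thesis by simp
    next
      case False
      let ?D = "set xs - {u, v}"
      have "card (set xs) \<le> k" using card_length[of xs] len by linarith
      moreover have "card {u, v} \<le> card (set xs)" using 4 by (intro card_mono) auto
      ultimately have D: "card ?D \<le> k - 2" "2 \<le> k"
        using 4 False by (auto simp: card_Diff_subset)
      then have "card ?D < k - 1" by linarith
      then obtain j where j: "j < k - 1" "sg (B j) \<inter> ?D = {}"
        using ex_disjoint_from[of ?D "k - 1" "\<lambda>i. sg (B i)"] disj by auto
      let ?B = "B j" and ?Y = "?D - B j"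
      have BT: "?B \<union> sg ?B \<subseteq> T" "maximal ?B" using B[OF j(1)] by auto
      have uvB: "u \<in> V - ?B" "v \<in> V - ?B" "u \<notin> sg ?B" "v \<notin> sg ?B" using uv BT by auto
      have simB: "sim ?B u v" using similar_antimono[OF uv(3)] BT by blast
      have "card ?Y \<le> card ?D" by (intro card_mono) auto
      then have Y: "card ?Y \<le> k - 2" using D by linarith
      then have "card (?Y \<union> {u, v}) \<le> k"
        using card_Un_le[of ?Y "{u, v}"] D False by simp
      then have "\<not> sim_class L M ?B u \<subseteq> ?Y \<union> {u, v}"
        using maximal_large_class[OF BT(2) uvB(1,3)] card_mono[of "?Y \<union> {u, v}" "sim_class L M ?B u"]
        by auto
      \<comment> \<open>The class of \<open>u\<close> has more than \<open>k\<close> elements, so it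
        contains a \<open>w\<close> that is not an entry of the tuple. It serves as temporary
        storage for the exchange.\<close>
      then obtain w where w: "w \<in> V - ?B" "sim ?B u w" "w \<notin> ?Y" "w \<noteq> u" "w \<noteq> v"
        by (auto simp: sim_class_def)
      have wsg: "w \<notin> sg ?B" using singlesD[of w L M ?B u] w similar_sym uvB by metis
      have sims: "sim ?B v u" "sim ?B w v"
        using simB w(2) similar_sym similar_trans by metis+
      have move: "sim (?B \<union> insert c ?Y) a b"
        if "{a, b, c} \<subseteq> {u, v, w}" "a \<noteq> c" "b \<noteq> c" "sim ?B a b" for a b c
      proof (rule maximal_no_split[OF BT(2) _ _ _ _ that(4)])
        show "insert c ?Y \<subseteq> V - ?B - sg ?B"
          using j(2) xs(3) that(1) uvB w(1) wsg by auto
        have "card (insert c ?Y) \<le> Suc (card ?Y)" by (simp add: card_insert_if)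
        then show "card (insert c ?Y) \<le> k - 1" using Y D by linarith
        show "a \<in> V - (?B \<union> insert c ?Y)" "b \<in> V - (?B \<union> insert c ?Y)"
          using that(1-3) uvB w(1,3) by auto
      qed
      \<comment> \<open>\<open>s a b\<close> writes \<open>a\<close> for \<open>u\<close> and
        \<open>b\<close> for \<open>v\<close>. The exchange runs through \<open>(u, v)\<close>,
        \<open>(w, v)\<close>, \<open>(w, u)\<close>, \<open>(v, u)\<close>; each step changes one
        value while the other one is held fixed in \<open>insert c ?Y\<close>.\<close>
      define s where "s a b = (\<lambda>x. if x = u then a else if x = v then b else x)" for a b
      have "rel M i (map (s u v) xs) = rel M i (map (s w v) xs)"
        by (rule similar_relD[OF move[of u w v] xs(1,2)])
          (use w False in \<open>auto simp: s_def\<close>)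
      moreover have "rel M i (map (s w v) xs) = rel M i (map (s w u) xs)"
        by (rule similar_relD[OF move[of v u w] xs(1,2)])
          (use w False sims in \<open>auto simp: s_def\<close>)
      moreover have "rel M i (map (s w u) xs) = rel M i (map (s v u) xs)"
        by (rule similar_relD[OF move[of w v u] xs(1,2)])
          (use w False sims in \<open>auto simp: s_def\<close>)
      moreover have "map (s u v) xs = xs" by (intro map_idI) (auto simp: s_def)
      moreover have "map (s v u) xs = map (transpose u v) xs"
        by (intro map_cong) (auto simp: s_def transpose_def)
      ultimately show ?thesis by simp
    qed
  qed
qed

text \<open>Each set of at most \<open>k - 1\<close> added elements is paid for by a gain of at
  least one unit of potential. The inequality is written additively to avoid truncated
  subtraction.\<close>

lemma maximal_extension:
  assumes "E \<subseteq> V"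
  shows "\<exists>B. E \<subseteq> B \<and> B \<subseteq> V \<and> maximal B \<and>
    card (B - E) + (k - 1) * potential E \<le> (k - 1) * potential B"
proof -
  \<comment> \<open>Instead of a greedy process, a member of largest potential is taken among all
    extensions that are paid for; a profitable addition would stay in the family.\<close>
  define \<F> where "\<F> = {B. E \<subseteq> B \<and> B \<subseteq> V \<and>
    card (B - E) + (k - 1) * potential E \<le> (k - 1) * potential B}"
  have fin: "finite \<F>" unfolding \<F>_def using finite_univ by (auto intro: finite_subset[of _ "Pow V"])
  have "E \<in> \<F>" unfolding \<F>_def using assms by simp
  then have "Max (potential ` \<F>) \<in> potential ` \<F>" using fin by (intro Max_in) auto
  then obtain B where B: "B \<in> \<F>" "potential B = Max (potential ` \<F>)" by auto
  have "maximal B" unfolding maximal_def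
  proof (intro allI impI, rule ccontr)
    fix Y assume Y: "Y \<subseteq> V - B" "card Y \<le> k - 1" "\<not> potential (B \<union> Y) \<le> potential B"
    have "B \<union> Y - E = (B - E) \<union> Y" using Y(1) B(1) unfolding \<F>_def by auto
    then have "card (B \<union> Y - E) \<le> card (B - E) + card Y" by (simp add: card_Un_le)
    moreover have "(k - 1) * Suc (potential B) \<le> (k - 1) * potential (B \<union> Y)"
      using Y(3) by (intro mult_le_mono2) simp
    ultimately have "B \<union> Y \<in> \<F>" using B(1) Y(1,2) unfolding \<F>_def by auto
    then have "potential (B \<union> Y) \<le> potential B" using B(2) fin by simp
    with Y(3) show False by simp
  qed
  with B(1) show ?thesis unfolding \<F>_def by blast
qed

text \<open>Freezing a singleton costs its class and its extra count, hence the factor 2. The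
  remaining classes are at most refined.\<close>

lemma potential_absorb_singles: "potential B \<le> potential (B \<union> sg B) + 2 * card (sg B)"
proof -
  let ?E = "B \<union> sg B"
  let ?c = "sim_class L M B"
  have sub: "sg B \<subseteq> V - B" by (rule singles_subset)
  then have "?c ` (V - B) = ?c ` sg B \<union> ?c ` (V - ?E)" by blast
  then have "num_classes L M B \<le> card (?c ` sg B) + card (?c ` (V - ?E))"
    unfolding num_classes_def by (simp add: card_Un_le)
  moreover have "card (?c ` sg B) \<le> card (sg B)" by (simp add: card_image_le)
  moreover have "card (?c ` (V - ?E)) \<le> num_classes L M ?E" unfolding num_classes_def
  proof (rule card_image_le_refine(1))
    fix x y assume xy: "x \<in> V - ?E" "y \<in> V - ?E" "sim_class L M ?E x = sim_class L M ?E y"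
    then have "sim ?E x y" by (simp add: sim_class_eq_iff)
    then have "sim B x y" by (rule similar_antimono) simp
    then show "?c x = ?c y" using xy by (subst sim_class_eq_iff) auto
  qed (use finite_univ in simp)
  ultimately show ?thesis unfolding potential_def by linarith
qed

lemma potential_le: "potential B \<le> 2 * card (sg B) + card (V - (B \<union> sg B))"
proof -
  have "V - B = sg B \<union> (V - (B \<union> sg B))" using singles_subset[of L M B] by blast
  then have "card (V - B) = card (sg B) + card (V - (B \<union> sg B))"
    using finite_univ card_Un_disjoint[of "sg B" "V - (B \<union> sg B)"] by auto
  moreover have "num_classes L M B \<le> card (V - B)"
    unfolding num_classes_def using finite_univ by (simp add: card_image_le)
  ultimately show ?thesis unfolding potential_def by linarith
qed

section \<open>Construction of the base and of the forced elements\<close>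

primrec forced :: "nat \<Rightarrow> 'a set \<Rightarrow> 'a set" where
  "forced 0 X = X"
| "forced (Suc i) X = forced i X \<union> sg (forced i X)"

lemma subset_forced: "X \<subseteq> forced i X"
  by (induction i) auto

lemma forced_subset: "X \<subseteq> V \<Longrightarrow> forced i X \<subseteq> V"
  using singles_subset[of L M] by (induction i) auto

lemma forced_mono: "X \<subseteq> X' \<Longrightarrow> forced i X \<subseteq> forced i X'"
proof (induction i)
  case (Suc i)
  then have "x \<in> sg (forced i X')" if "x \<in> sg (forced i X)" "x \<notin> forced i X'" for x
    using singles_mono that by metis
  with Suc show ?case by auto
qed simp

text \<open>\<open>X\<close> holds the elements that Spoiler plays, and \<open>E\<close> adds the
  singletons frozen in the layers. The bound with \<open>potential E\<close> is the invariant of the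
  induction on \<open>r\<close>. The last bound is the one wanted in the end; it is derived anew in
  each layer, since \<open>potential E\<close> can exceed \<open>card (V - E)\<close>.\<close>

definition layered :: "nat \<Rightarrow> 'a set \<Rightarrow> 'a set \<Rightarrow> (nat \<Rightarrow> 'a set) \<Rightarrow> bool" where
  "layered r X E B \<longleftrightarrow> X \<subseteq> E \<and> E \<subseteq> V \<and> E \<subseteq> forced r X \<and>
     (\<forall>i<r. maximal (B i) \<and> B i \<union> sg (B i) \<subseteq> E) \<and>
     (\<forall>i<r. \<forall>j<r. i \<noteq> j \<longrightarrow> sg (B i) \<inter> sg (B j) = {}) \<and>
     card X \<le> (k - 1) * (2 * card (E - X) + potential E) \<and>
     card X \<le> (k - 1) * (2 * card (E - X) + card (V - E))"

lemma ex_layered: "\<exists>X E B. layered r X E B"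
proof (induction r)
  case 0
  have "layered 0 {} {} B" for B by (simp add: layered_def)
  then show ?case by blast
next
  case (Suc r)
  then obtain X E B where XEB: "layered r X E B" by blast
  have IH: "X \<subseteq> E" "E \<subseteq> V" "E \<subseteq> forced r X"
    "\<And>i. i < r \<Longrightarrow> maximal (B i) \<and> B i \<union> sg (B i) \<subseteq> E"
    "\<And>i j. i < r \<Longrightarrow> j < r \<Longrightarrow> i \<noteq> j \<Longrightarrow> sg (B i) \<inter> sg (B j) = {}"
    "card X \<le> (k - 1) * (2 * card (E - X) + potential E)"
    using XEB unfolding layered_def by simp_all
  from maximal_extension[OF IH(2)] obtain C where C: "E \<subseteq> C" "C \<subseteq> V" "maximal C"
    "card (C - E) + (k - 1) * potential E \<le> (k - 1) * potential C" by blast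
  \<comment> \<open>Spoiler also plays the elements of the maximal extension, whereas the singletons
    over \<open>C\<close> are frozen without being played.\<close>
  define X' where "X' = X \<union> (C - E)"
  define E' where "E' = C \<union> sg C"
  define B' where "B' = B(r := C)"
  have sgC: "sg C \<subseteq> V - C" by (rule singles_subset)
  have fin: "finite E" "finite C" "finite X"
    using IH(1,2) C(2) finite_univ by (meson finite_subset order_trans)+
  have "card X' = card X + card (C - E)"
    unfolding X'_def using fin IH(1) by (intro card_Un_disjoint) auto
  also have "\<dots> \<le> (k - 1) * (2 * card (E - X) + potential E) + card (C - E)" using IH(6) by simp
  also have "\<dots> \<le> (k - 1) * (2 * card (E - X) + potential C)"
    using C(4) by (simp add: distrib_left)
  finally have X': "card X' \<le> (k - 1) * (2 * card (E - X) + potential C)" .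
  have "E' - X' = (E - X) \<union> sg C" unfolding E'_def X'_def using IH(1) C(1) sgC by blast
  moreover have "(E - X) \<inter> sg C = {}" using C(1) sgC by blast
  ultimately have EX': "card (E' - X') = card (E - X) + card (sg C)"
    using fin by (simp add: card_Un_disjoint)
  have "2 * card (E - X) + potential C \<le> 2 * card (E' - X') + potential E'"
    using potential_absorb_singles[of C] EX' unfolding E'_def by linarith
  from order_trans[OF X' mult_le_mono2[OF this]]
  have 1: "card X' \<le> (k - 1) * (2 * card (E' - X') + potential E')" .
  have "2 * card (E - X) + potential C \<le> 2 * card (E' - X') + card (V - E')"
    using potential_le[of C] EX' unfolding E'_def by linarith
  from order_trans[OF X' mult_le_mono2[OF this]]
  have 2: "card X' \<le> (k - 1) * (2 * card (E' - X') + card (V - E'))" .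
  have "E \<subseteq> forced r X'" using IH(3) forced_mono[of X X' r] unfolding X'_def by blast
  then have Ch: "C \<subseteq> forced r X'" using subset_forced[of X' r] unfolding X'_def by blast
  \<comment> \<open>Singletons over \<open>C\<close> stay singletons over the larger set
    \<open>forced r X'\<close>, so the next iteration of \<open>forced\<close> absorbs them.\<close>
  then have "x \<in> sg (forced r X')" if "x \<in> sg C" "x \<notin> forced r X'" for x
    using singles_mono that by metis
  with Ch have 3: "E' \<subseteq> forced (Suc r) X'" unfolding E'_def by auto
  have 4: "X' \<subseteq> E'" "E' \<subseteq> V" unfolding X'_def E'_def using IH(1) C sgC by auto
  have EE': "E \<subseteq> E'" using C(1) unfolding E'_def by blast
  have 5: "maximal (B' i) \<and> B' i \<union> sg (B' i) \<subseteq> E'" if "i < Suc r" for i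
  proof (cases "i = r")
    case True
    then show ?thesis using C(3) unfolding B'_def E'_def by simp
  next
    case False
    then show ?thesis using IH(4)[of i] EE' that unfolding B'_def by auto
  qed
  \<comment> \<open>Earlier singletons lie in \<open>E\<close> and thus in \<open>C\<close>, while
    those over \<open>C\<close> lie outside \<open>C\<close>.\<close>
  have old: "sg (B i) \<inter> sg C = {}" if "i < r" for i
    using IH(4)[OF that] C(1) sgC by blast
  have 6: "sg (B' i) \<inter> sg (B' j) = {}" if "i < Suc r" "j < Suc r" "i \<noteq> j" for i j
    using that IH(5)[of i j] old[of i] old[of j] unfolding B'_def
    by (cases "i = r"; cases "j = r") (auto simp: Int_commute)
  have "layered (Suc r) X' E' B'" unfolding layered_def
    using 1 2 3 4 5 6 by (intro conjI allI impI) simp_all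
  then show ?case by blast
qed

section \<open>Exchanging similar elements in \<open>M\<close>\<close>

definition interchangeable :: "'a set \<Rightarrow> bool" where
  "interchangeable T \<longleftrightarrow> (\<forall>u\<in>V - T. \<forall>v\<in>V - T. sim T u v \<longrightarrow>
     (\<forall>i<length L. \<forall>xs. length xs = L ! i \<longrightarrow> set xs \<subseteq> V \<longrightarrow>
        (rel M i (map (transpose u v) xs) \<longleftrightarrow> rel M i xs)))"

lemma ex_base:
  "\<exists>X\<subseteq>V. interchangeable (forced (k - 1) X) \<and>
     card X \<le> (k - 1) * (card (forced (k - 1) X - X) + card (V - X))"
proof -
  obtain X E B where XEB: "layered (k - 1) X E B" using ex_layered by blast
  have *: "X \<subseteq> E" "E \<subseteq> V" "E \<subseteq> forced (k - 1) X"
    "\<And>i. i < k - 1 \<Longrightarrow> maximal (B i) \<and> B i \<union> sg (B i) \<subseteq> E"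
    "\<And>i j. i < k - 1 \<Longrightarrow> j < k - 1 \<Longrightarrow> i \<noteq> j \<Longrightarrow> sg (B i) \<inter> sg (B j) = {}"
    "card X \<le> (k - 1) * (2 * card (E - X) + card (V - E))"
    using XEB unfolding layered_def by simp_all
  let ?T = "forced (k - 1) X"
  have XV: "X \<subseteq> V" using *(1,2) by blast
  have fin: "finite ?T" using forced_subset[OF XV] finite_univ finite_subset by blast
  have "V - X = (E - X) \<union> (V - E)" "(E - X) \<inter> (V - E) = {}" using *(1,2) by auto
  then have "card (V - X) = card (E - X) + card (V - E)"
    using finite_subset[OF *(2) finite_univ] finite_univ by (simp add: card_Un_disjoint)
  moreover have "card (E - X) \<le> card (?T - X)" using *(3) fin by (intro card_mono) auto
  ultimately have "2 * card (E - X) + card (V - E) \<le> card (?T - X) + card (V - X)" by linarith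
  from order_trans[OF *(6) mult_le_mono2[OF this]]
  have "card X \<le> (k - 1) * (card (?T - X) + card (V - X))" .
  moreover have "interchangeable ?T" unfolding interchangeable_def
  proof (intro ballI allI impI)
    fix u v i xs
    assume "u \<in> V - ?T" "v \<in> V - ?T" "sim ?T u v" "i < length L" "length xs = L ! i" "set xs \<subseteq> V"
    then show "rel M i (map (transpose u v) xs) \<longleftrightarrow> rel M i xs"
      by (intro layers_transpose_preserves[of B ?T u v i xs]) (use *(3-5) in blast)+
  qed
  ultimately show ?thesis using XV by blast
qed

text \<open>The map \<open>\<rho>\<close> is resolved into transpositions of similar elements.
  Exchanging a moved entry \<open>v\<close> with \<open>w = \<rho> v\<close> puts it in place, so
  that the modified tuple has fewer moved entries and the same image.\<close>

lemma interchangeable_rel: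
  assumes "interchangeable T" "i < length L"
  shows "length xs = L ! i \<Longrightarrow> set xs \<subseteq> V \<Longrightarrow> inj_on \<rho> (set xs) \<Longrightarrow>
    (\<And>x. x \<in> set xs \<Longrightarrow> \<rho> x = x \<or> x \<in> V - T \<and> \<rho> x \<in> V - T \<and> sim T x (\<rho> x)) \<Longrightarrow>
    rel M i (map \<rho> xs) \<longleftrightarrow> rel M i xs"
proof (induction "card {x \<in> set xs. \<rho> x \<noteq> x}" arbitrary: xs \<rho> rule: less_induct)
  case less
  show ?case
  proof (cases "\<forall>x\<in>set xs. \<rho> x = x")
    case True
    then have "map \<rho> xs = xs" by (simp add: map_idI)
    then show ?thesis by simp
  next
    case False
    then obtain v where v: "v \<in> set xs" "\<rho> v \<noteq> v" by blast
    define w where "w = \<rho> v"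
    have vw: "v \<noteq> w" "v \<in> V - T" "w \<in> V - T" "sim T v w"
      using v less.prems(4)[of v] unfolding w_def by auto
    let ?t = "transpose v w"
    let ?ys = "map ?t xs" and ?\<pi> = "\<rho> \<circ> ?t"
    \<comment> \<open>By injectivity \<open>w\<close> is itself moved if it is an entry, so putting
      \<open>v\<close> in place disturbs no fixed entry.\<close>
    have ww: "w \<in> set xs \<Longrightarrow> \<rho> w \<noteq> w"
      using v less.prems(3) vw(1) unfolding w_def inj_on_def by metis
    have "rel M i (map ?\<pi> ?ys) \<longleftrightarrow> rel M i ?ys"
    proof (rule less.hyps)
      have "{y \<in> set ?ys. ?\<pi> y \<noteq> y} \<subseteq> ?t ` ({x \<in> set xs. \<rho> x \<noteq> x} - {v})"
      proof
        fix y assume "y \<in> {y \<in> set ?ys. ?\<pi> y \<noteq> y}"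
        then obtain x where x: "x \<in> set xs" "y = ?t x" "\<rho> x \<noteq> ?t x" by auto
        have "x \<noteq> v" using x(3) by (auto simp: w_def)
        moreover have "\<rho> x \<noteq> x"
        proof (cases "x = w")
          case True
          then show ?thesis using ww x(1) by blast
        next
          case False
          then show ?thesis using x(3) \<open>x \<noteq> v\<close> by simp
        qed
        ultimately show "y \<in> ?t ` ({x \<in> set xs. \<rho> x \<noteq> x} - {v})" using x by blast
      qed
      then have "card {y \<in> set ?ys. ?\<pi> y \<noteq> y} \<le> card (?t ` ({x \<in> set xs. \<rho> x \<noteq> x} - {v}))"
        by (intro card_mono) auto
      also have "\<dots> \<le> card ({x \<in> set xs. \<rho> x \<noteq> x} - {v})" by (intro card_image_le) simp
      also have "\<dots> < card {x \<in> set xs. \<rho> x \<noteq> x}"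
        using v by (intro card_Diff1_less) auto
      finally show "card {y \<in> set ?ys. ?\<pi> y \<noteq> y} < card {x \<in> set xs. \<rho> x \<noteq> x}" .
      show "length ?ys = L ! i" using less.prems(1) by simp
      show "set ?ys \<subseteq> V" using less.prems(2) vw by (auto simp: transpose_def)
      show "inj_on ?\<pi> (set ?ys)" using less.prems(3) by (auto simp: inj_on_def)
      fix y assume "y \<in> set ?ys"
      then obtain x where x: "x \<in> set xs" "y = ?t x" by auto
      have px: "?\<pi> y = \<rho> x" using x(2) by simp
      consider "x = v" | "x = w" | "x \<noteq> v" "x \<noteq> w" by blast
      then show "?\<pi> y = y \<or> y \<in> V - T \<and> ?\<pi> y \<in> V - T \<and> sim T y (?\<pi> y)"
      proof cases
        case 1
        then show ?thesis using px x(2) by (simp add: w_def)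
      next
        case 2
        then have "\<rho> x \<in> V - T" "sim T w (\<rho> x)" using less.prems(4)[OF x(1)] ww x(1) by auto
        moreover have "y = v" using 2 x(2) by simp
        ultimately show ?thesis using px vw(2,4) similar_trans by metis
      next
        case 3
        then show ?thesis using less.prems(4)[OF x(1)] px x(2) by simp
      qed
    qed
    moreover have "map ?\<pi> ?ys = map \<rho> xs" by simp
    moreover have "rel M i ?ys \<longleftrightarrow> rel M i xs"
      using assms vw less.prems(1,2) unfolding interchangeable_def by blast
    ultimately show ?thesis by (simp only:)
  qed
qed

end

section \<open>Forced replies\<close>

text \<open>Spoiler can punish, within \<open>c\<close> moves in whichever structure he likes, every pair that violates
  the correspondence \<open>\<Gamma>\<close>.\<close>

definition certified ::
  "vocabulary \<Rightarrow> 'a struct \<Rightarrow> 'b struct \<Rightarrow> ('a \<times> 'b) set \<Rightarrow> ('a \<times> 'b) set \<Rightarrow> nat \<Rightarrow> bool" where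
  "certified L M N P \<Gamma> c \<longleftrightarrow> (\<forall>Q p q. P \<subseteq> Q \<longrightarrow> Q \<subseteq> univ M \<times> univ N \<longrightarrow> p \<in> Q \<longrightarrow> q \<in> \<Gamma> \<longrightarrow>
     eq_clash p q \<longrightarrow> ewin L M N c Q \<and> ewin L N M c (Q\<inverse>))"

text \<open>For the same bound this is stronger than \<open>certified\<close>: it also covers pairs
  that violate a relation together with \<open>\<Gamma>\<close>. Since \<open>Q\<close> is any later
  position, the guarantee persists during further play.\<close>

definition detects ::
  "vocabulary \<Rightarrow> 'a struct \<Rightarrow> 'b struct \<Rightarrow> ('a \<times> 'b) set \<Rightarrow> ('a \<times> 'b) set \<Rightarrow> nat \<Rightarrow> bool" where
  "detects L M N P \<Gamma> d \<longleftrightarrow> (\<forall>Q p. P \<subseteq> Q \<longrightarrow> Q \<subseteq> univ M \<times> univ N \<longrightarrow> p \<in> Q \<longrightarrow>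
     conflict L M N (insert p \<Gamma>) \<longrightarrow> ewin L M N d Q \<and> ewin L N M d (Q\<inverse>))"

lemma certifiedD:
  "certified L M N P \<Gamma> c \<Longrightarrow> P \<subseteq> Q \<Longrightarrow> Q \<subseteq> univ M \<times> univ N \<Longrightarrow> p \<in> Q \<Longrightarrow> q \<in> \<Gamma> \<Longrightarrow> eq_clash p q \<Longrightarrow>
    ewin L M N c Q \<and> ewin L N M c (Q\<inverse>)"
  unfolding certified_def by blast

lemma detectsD:
  "detects L M N P \<Gamma> d \<Longrightarrow> P \<subseteq> Q \<Longrightarrow> Q \<subseteq> univ M \<times> univ N \<Longrightarrow> p \<in> Q \<Longrightarrow>
    conflict L M N (insert p \<Gamma>) \<Longrightarrow> ewin L M N d Q \<and> ewin L N M d (Q\<inverse>)"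
  unfolding detects_def by blast

lemma eq_clash_swap [simp]: "eq_clash (prod.swap p) (prod.swap q) \<longleftrightarrow> eq_clash p q"
  by (auto simp: eq_clash_def)

lemma certified_converse:
  assumes "certified L M N P \<Gamma> c"
  shows "certified L N M (P\<inverse>) (\<Gamma>\<inverse>) c"
  unfolding certified_def
proof (intro allI impI)
  fix Q p q assume *: "P\<inverse> \<subseteq> Q" "Q \<subseteq> univ N \<times> univ M" "p \<in> Q" "q \<in> \<Gamma>\<inverse>" "eq_clash p q"
  have "ewin L M N c (Q\<inverse>) \<and> ewin L N M c ((Q\<inverse>)\<inverse>)"
    by (rule certifiedD[OF assms, where p = "prod.swap p" and q = "prod.swap q"]) (use * in auto)
  then show "ewin L N M c Q \<and> ewin L M N c (Q\<inverse>)" by simp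
qed

lemma conflict_insert_eq_clash: "q \<in> \<Gamma> \<Longrightarrow> eq_clash p q \<Longrightarrow> conflict L M N (insert p \<Gamma>)"
  unfolding conflict_def by blast

lemma conflict_eq_clash: "p \<in> Q \<Longrightarrow> q \<in> Q \<Longrightarrow> eq_clash p q \<Longrightarrow> conflict L M N Q"
  unfolding conflict_def by blast

lemma detects_self: "detects L M N P P 0"
  unfolding detects_def
proof (intro allI impI)
  fix Q p assume "P \<subseteq> Q" "p \<in> Q" "conflict L M N (insert p P)"
  then have "conflict L M N Q" using conflict_mono by (metis insert_subset)
  then show "ewin L M N 0 Q \<and> ewin L N M 0 (Q\<inverse>)" by simp
qed

text \<open>Spoiler plays the first components of \<open>G\<close>. Either Duplicator answers with
  the partners given by \<open>G\<close>, or a reply clashes with a pair of \<open>\<Gamma>\<close>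
  and is punished within \<open>c\<close> rounds.\<close>

lemma certified_play:
  assumes "certified L M N P \<Gamma> c" "\<Gamma> \<subseteq> univ M \<times> univ N" "finite G" "G \<subseteq> \<Gamma>"
    and Q: "P \<subseteq> Q" "Q \<subseteq> univ M \<times> univ N" and "ewin L M N c (Q \<union> G)"
  shows "ewin L M N (card G + c) Q"
proof -
  have "ewin L M N (card (fst ` G) + c) Q"
  proof (rule ewin_play)
    show "finite (fst ` G)" "fst ` G \<subseteq> univ M" using assms(2-4) by auto
    fix \<rho> assume "\<rho> ` fst ` G \<subseteq> univ N"
    then have \<rho>: "\<rho> (fst g) \<in> univ N" if "g \<in> G" for g using that by blast
    let ?Q = "Q \<union> (\<lambda>a. (a, \<rho> a)) ` fst ` G"
    have sub: "P \<subseteq> ?Q" "?Q \<subseteq> univ M \<times> univ N" using Q \<rho> assms(2,4) by fastforce+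
    show "ewin L M N c ?Q"
    proof (cases "\<forall>g\<in>G. \<rho> (fst g) = snd g")
      case True
      then have "g \<in> ?Q" if "g \<in> G" for g
        using that by (intro UnI2 image_eqI[of _ _ "fst g"]) auto
      then have "Q \<union> G \<subseteq> ?Q" by blast
      then show ?thesis using assms(7) ewin_mono by blast
    next
      case False
      then obtain g where g: "g \<in> G" "\<rho> (fst g) \<noteq> snd g" by blast
      then have "eq_clash (fst g, \<rho> (fst g)) g" "g \<in> \<Gamma>" "(fst g, \<rho> (fst g)) \<in> ?Q"
        using assms(4) by (auto simp: eq_clash_def)
      then show ?thesis using certifiedD[OF assms(1) sub] by blast
    qed
  qed
  then show ?thesis by (rule ewin_mono_rounds) (use assms(3) in \<open>simp add: card_image_le\<close>)
qed

text \<open>A conflict inside \<open>\<Gamma>\<close> involves at most \<open>k\<close> pairs, which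
  Spoiler can bring onto the board.\<close>

lemma certified_conflict:
  assumes c: "certified L M N P \<Gamma> c" "\<Gamma> \<subseteq> univ M \<times> univ N" "P \<subseteq> univ M \<times> univ N"
    and "conflict L M N \<Gamma>" and k: "0 < k" "\<And>i. i < length L \<Longrightarrow> L ! i \<le> k"
  shows "ewin L M N (k + c) P"
proof -
  from assms(4) consider p q where "p \<in> \<Gamma>" "q \<in> \<Gamma>" "eq_clash p q"
    | i zs where "i < length L" "length zs = L ! i" "set zs \<subseteq> \<Gamma>"
      "rel M i (map fst zs) \<noteq> rel N i (map snd zs)"
    unfolding conflict_def by blast
  then show ?thesis
  proof cases
    case 1
    have "ewin L M N c (P \<union> {p})"
      using certifiedD[OF c(1), of "P \<union> {p}" p q] 1 c(2,3) by blast
    then have "ewin L M N (card {p} + c) P"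
      using 1 by (intro certified_play[OF c(1,2) _ _ order_refl c(3)]) auto
    then show ?thesis by (rule ewin_mono_rounds) (use k(1) in simp)
  next
    case 2
    then have "conflict L M N (P \<union> set zs)" unfolding conflict_def by blast
    then have "ewin L M N (card (set zs) + c) P"
      using 2 by (intro certified_play[OF c(1,2) _ _ order_refl c(3)]) (auto intro: conflict_ewin)
    moreover have "card (set zs) \<le> k" using card_length[of zs] k(2)[OF 2(1)] 2(2) by simp
    ultimately show ?thesis by (elim ewin_mono_rounds) simp
  qed
qed

text \<open>As \<open>\<Gamma>\<close> alone is free of conflict, \<open>p\<close> takes part in the
  conflict and is already on the board. At most \<open>k - 1\<close> other pairs remain to be
  played; this is the price of one iteration.\<close>

lemma certified_mismatch:
  assumes c: "certified L M N P \<Gamma> c" "\<Gamma> \<subseteq> univ M \<times> univ N" and Q: "P \<subseteq> Q" "Q \<subseteq> univ M \<times> univ N"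
    and "\<not> conflict L M N \<Gamma>" "p \<in> Q" "conflict L M N (insert p \<Gamma>)"
    and k: "\<And>i. i < length L \<Longrightarrow> L ! i \<le> k"
  shows "ewin L M N (k - 1 + c) Q"
proof -
  from assms(7) consider a b where "a \<in> insert p \<Gamma>" "b \<in> insert p \<Gamma>" "eq_clash a b"
    | i zs where "i < length L" "length zs = L ! i" "set zs \<subseteq> insert p \<Gamma>"
      "rel M i (map fst zs) \<noteq> rel N i (map snd zs)"
    unfolding conflict_def by blast
  then show ?thesis
  proof cases
    case 1
    have "\<not> (a \<in> \<Gamma> \<and> b \<in> \<Gamma>)" using assms(5) 1(3) unfolding conflict_def by blast
    moreover have "a \<noteq> b" using 1(3) by (auto simp: eq_clash_def)
    moreover have "eq_clash b a" using 1(3) by (auto simp: eq_clash_def)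
    ultimately obtain q where "q \<in> \<Gamma>" "eq_clash p q" using 1 by blast
    with certifiedD[OF c(1) Q assms(6)] have "ewin L M N c Q" by blast
    then show ?thesis by (rule ewin_mono_rounds) simp
  next
    case 2
    let ?G = "set zs - {p}"
    have "p \<in> set zs"
    proof (rule ccontr)
      assume "p \<notin> set zs"
      then have "set zs \<subseteq> \<Gamma>" using 2(3) by blast
      with 2 assms(5) show False unfolding conflict_def by blast
    qed
    then have "card ?G \<le> k - 1" using card_length[of zs] k[OF 2(1)] 2(2) by simp
    moreover have "set zs \<subseteq> Q \<union> ?G" using assms(6) by blast
    then have "conflict L M N (Q \<union> ?G)" unfolding conflict_def using 2 by blast
    then have "ewin L M N (card ?G + c) Q"
      using 2(3) by (intro certified_play[OF c _ _ Q]) (auto intro: conflict_ewin)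
    ultimately show ?thesis by (elim ewin_mono_rounds) simp
  qed
qed

lemma certified_detects:
  assumes c: "certified L M N P \<Gamma> c" "\<Gamma> \<subseteq> univ M \<times> univ N" "\<not> conflict L M N \<Gamma>"
    and k: "\<And>i. i < length L \<Longrightarrow> L ! i \<le> k"
  shows "detects L M N P \<Gamma> (k - 1 + c)"
  unfolding detects_def
proof (intro allI impI conjI)
  fix Q p assume Q: "P \<subseteq> Q" "Q \<subseteq> univ M \<times> univ N" "p \<in> Q" "conflict L M N (insert p \<Gamma>)"
  show "ewin L M N (k - 1 + c) Q"
    by (rule certified_mismatch[OF c(1,2) Q(1,2) c(3) Q(3,4) k])
  have "(insert p \<Gamma>)\<inverse> = insert (prod.swap p) (\<Gamma>\<inverse>)" by (auto simp: prod.swap_def)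
  then have "conflict L N M (insert (prod.swap p) (\<Gamma>\<inverse>))" using Q(4) by (metis conflict_converse)
  then show "ewin L N M (k - 1 + c) (Q\<inverse>)"
    by (intro certified_mismatch[OF certified_converse[OF c(1)] _ _ _ _ _ _ k, where p = "prod.swap p"])
      (use Q c in auto)
qed

text \<open>Follow one partial isomorphism to \<open>w\<close> and return along the inverse of the
  other.\<close>

lemma similar_of_common_partner:
  assumes "\<not> conflict L M N (insert (x, w) \<Gamma>)" "\<not> conflict L M N (insert (s, w) \<Gamma>)" "fst ` \<Gamma> = T"
  shows "similar L M T x s"
proof -
  have "insert (x, s) (Id_on T) \<subseteq> insert (x, w) \<Gamma> O (insert (s, w) \<Gamma>)\<inverse>"
    using assms(3) by force
  then show ?thesis unfolding similar_def
    using assms(1,2) by (metis conflict_converse conflict_mono conflict_relcomp)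
qed

lemma not_conflict_similar:
  assumes "\<not> conflict L M N (insert (v, w) \<Gamma>)" "similar L M (fst ` \<Gamma>) x v"
  shows "\<not> conflict L M N (insert (x, w) \<Gamma>)"
proof -
  have "insert (x, w) \<Gamma> \<subseteq> insert (x, v) (Id_on (fst ` \<Gamma>)) O insert (v, w) \<Gamma>" by force
  then show ?thesis using assms unfolding similar_def by (metis conflict_mono conflict_relcomp)
qed

lemma similar_in_imp_eq: "similar L M T x s \<Longrightarrow> x \<in> T \<Longrightarrow> x = s"
  using conflict_eq_clash[of "(x, s)" "insert (x, s) (Id_on T)" "(x, x)" L M M]
  by (auto simp: similar_def eq_clash_def)

text \<open>Each singleton \<open>s\<close> has exactly one compatible partner. With none, Spoiler
  wins by playing \<open>s\<close>; with two, he plays both in \<open>N\<close>, where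
  \<open>s\<close> is the only undetected reply to either. These arguments account for the
  \<open>1 + d\<close> and \<open>2 + d\<close> rounds.\<close>

lemma detects_extend:
  assumes d: "detects L M N P \<Gamma> d" "\<Gamma> \<subseteq> univ M \<times> univ N" "P \<subseteq> univ M \<times> univ N"
    and T: "fst ` \<Gamma> = T"
    and nowin: "\<not> ewin L M N (1 + d) P" "\<not> ewin L N M (2 + d) (P\<inverse>)"
  defines "\<Gamma>' \<equiv> \<Gamma> \<union> {(s, w). s \<in> singles L M T \<and> w \<in> univ N \<and> \<not> conflict L M N (insert (s, w) \<Gamma>)}"
  shows "certified L M N P \<Gamma>' d" "fst ` \<Gamma>' = T \<union> singles L M T"
proof -
  let ?ok = "\<lambda>p. \<not> conflict L M N (insert p \<Gamma>)"
  have only: "x = s" if "s \<in> singles L M T" "?ok (s, w)" "?ok (x, w)" "x \<in> univ M" for s w x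
  proof -
    have sim: "similar L M T x s" by (rule similar_of_common_partner[OF that(3,2) T])
    show ?thesis
    proof (cases "x \<in> T")
      case True
      then show ?thesis using similar_in_imp_eq[OF sim] by blast
    next
      case False
      then show ?thesis using singlesD[OF that(1) _ similar_sym[OF sim]] that(4) by blast
    qed
  qed
  have ex: "\<exists>w\<in>univ N. ?ok (s, w)" if s: "s \<in> singles L M T" for s
  proof (rule ccontr)
    assume no: "\<not> (\<exists>w\<in>univ N. ?ok (s, w))"
    have sV: "s \<in> univ M" using s singles_subset[of L M T] by blast
    have "ewin L M N (card {s} + d) P"
    proof (rule ewin_play)
      fix \<rho> assume "\<rho> ` {s} \<subseteq> univ N"
      then show "ewin L M N d (P \<union> (\<lambda>a. (a, \<rho> a)) ` {s})"
        using detectsD[OF d(1), of "insert (s, \<rho> s) P" "(s, \<rho> s)"] no d(3) sV by auto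
    qed (use sV in auto)
    moreover have "card {s} = 1" by simp
    ultimately show False using nowin(1) by metis
  qed
  have uniq: "w = w'" if s: "s \<in> singles L M T" and w: "w \<in> univ N" "?ok (s, w)"
    and w': "w' \<in> univ N" "?ok (s, w')" for s w w'
  proof (rule ccontr)
    assume ne: "w \<noteq> w'"
    have "ewin L N M (card {w, w'} + d) (P\<inverse>)"
    proof (rule ewin_play)
      fix \<rho> assume \<rho>: "\<rho> ` {w, w'} \<subseteq> univ M"
      let ?Q = "P\<inverse> \<union> (\<lambda>a. (a, \<rho> a)) ` {w, w'}"
      have "P \<subseteq> ?Q\<inverse>" "?Q\<inverse> \<subseteq> univ M \<times> univ N" using d(3) \<rho> w w' by auto
      note D = detectsD[OF d(1) this]
      show "ewin L N M d ?Q"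
      proof (cases "?ok (\<rho> w, w) \<and> ?ok (\<rho> w', w')")
        case True
        then have "\<rho> w = s" "\<rho> w' = s" using only[OF s] w w' \<rho> by auto
        then have "eq_clash (w, \<rho> w) (w', \<rho> w')" using ne by (simp add: eq_clash_def)
        then have "conflict L N M ?Q" by (intro conflict_eq_clash[of "(w, \<rho> w)" _ "(w', \<rho> w')"]) auto
        then show ?thesis by (rule conflict_ewin)
      next
        case False
        then show ?thesis using D[of "(\<rho> w, w)"] D[of "(\<rho> w', w')"] by auto
      qed
    qed (use w w' in auto)
    moreover have "card {w, w'} = 2" using ne by simp
    ultimately show False using nowin(2) by metis
  qed
  show "certified L M N P \<Gamma>' d" unfolding certified_def
  proof (intro allI impI)
    fix Q p q assume Q: "P \<subseteq> Q" "Q \<subseteq> univ M \<times> univ N" "p \<in> Q" and q: "q \<in> \<Gamma>'" and cl: "eq_clash p q"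
    \<comment> \<open>A pair compatible with \<open>\<Gamma>\<close> cannot clash with an added
      pair: \<open>only\<close> settles a shared second component and \<open>uniq\<close> a shared
      first one.\<close>
    have "conflict L M N (insert p \<Gamma>)"
    proof (rule ccontr)
      assume ok: "?ok p"
      obtain x y where p: "p = (x, y)" by force
      then have xy: "x \<in> univ M" "y \<in> univ N" using Q by auto
      from ok cl have "q \<notin> \<Gamma>" using conflict_insert_eq_clash by blast
      then obtain s w where sw: "q = (s, w)" "s \<in> singles L M T" "w \<in> univ N" "?ok (s, w)"
        using q unfolding \<Gamma>'_def by blast
      have "x = s" if "y = w" using only[of s w x] sw ok p xy that by simp
      moreover have "y = w" if "x = s" using uniq[of s y w] sw ok p xy that by simp
      ultimately have "(x = s) = (y = w)" by iprover
      then show False using cl unfolding p sw(1) eq_clash_def by simp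
    qed
    from detectsD[OF d(1) Q this] show "ewin L M N d Q \<and> ewin L N M d (Q\<inverse>)" .
  qed
  show "fst ` \<Gamma>' = T \<union> singles L M T"
  proof
    show "fst ` \<Gamma>' \<subseteq> T \<union> singles L M T" using T unfolding \<Gamma>'_def by auto
    show "T \<union> singles L M T \<subseteq> fst ` \<Gamma>'"
    proof
      fix x assume "x \<in> T \<union> singles L M T"
      then consider "x \<in> fst ` \<Gamma>" | "x \<in> singles L M T" using T by blast
      then show "x \<in> fst ` \<Gamma>'"
      proof cases
        case 1
        then show ?thesis unfolding \<Gamma>'_def by blast
      next
        case 2
        then obtain w where "w \<in> univ N" "?ok (x, w)" using ex by blast
        with 2 have "(x, w) \<in> \<Gamma>'" unfolding \<Gamma>'_def by blast
        then show ?thesis by (intro image_eqI[of _ _ "(x, w)"]) simp_all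
      qed
    qed
  qed
qed

section \<open>Comparing class sizes\<close>

text \<open>Since the totals agree, unequal fibres occur in both directions, at \<open>t1\<close>
  and at \<open>t2\<close>. The smaller fibres at these two values have fewer than \<open>m\<close>
  elements together, so one of them has less than half.\<close>

lemma bij_or_unequal_fibre:
  assumes "finite A" "finite B" "card A = m" "card B = m"
  obtains h where "bij_betw h A B" "\<And>x. x \<in> A \<Longrightarrow> b (h x) = a x"
  | t where "card {x \<in> A. a x = t} < card {y \<in> B. b y = t}" "2 * card {x \<in> A. a x = t} < m"
  | t where "card {y \<in> B. b y = t} < card {x \<in> A. a x = t}" "2 * card {y \<in> B. b y = t} < m"
proof -
  let ?p = "\<lambda>t. card {x \<in> A. a x = t}" and ?q = "\<lambda>t. card {y \<in> B. b y = t}"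
  show ?thesis
  proof (cases "\<forall>t. ?p t = ?q t")
    case True
    have "\<exists>h. bij_betw h {x \<in> A. a x = t} {y \<in> B. b y = t}" for t
      using True assms(1,2) by (intro finite_same_card_bij) auto
    then obtain h where h: "\<And>t. bij_betw (h t) {x \<in> A. a x = t} {y \<in> B. b y = t}" by metis
    have hB: "h (a x) x \<in> B \<and> b (h (a x) x) = a x" if "x \<in> A" for x
      using bij_betwE[OF h[of "a x"]] that by blast
    have "bij_betw (\<lambda>x. h (a x) x) A B"
    proof (rule bij_betw_imageI)
      show "inj_on (\<lambda>x. h (a x) x) A"
      proof (rule inj_onI)
        fix x y assume xy: "x \<in> A" "y \<in> A" "h (a x) x = h (a y) y"
        then have "a x = a y" using hB by metis
        then show "x = y" using xy h[of "a x"] unfolding bij_betw_def inj_on_def by simp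
      qed
      show "(\<lambda>x. h (a x) x) ` A = B"
      proof
        show "B \<subseteq> (\<lambda>x. h (a x) x) ` A"
        proof
          fix y assume "y \<in> B"
          then have "y \<in> h (b y) ` {x \<in> A. a x = b y}" using h[of "b y"] unfolding bij_betw_def by simp
          then obtain x where "x \<in> A" "a x = b y" "y = h (b y) x" by blast
          then show "y \<in> (\<lambda>x. h (a x) x) ` A" by (intro image_eqI[of _ _ x]) simp_all
        qed
      qed (use hB in blast)
    qed
    then show ?thesis using that(1) hB by blast
  next
    case False
    then obtain t0 where t0: "?p t0 \<noteq> ?q t0" by blast
    let ?S = "insert t0 (a ` A \<union> b ` B)"
    have fin: "finite ?S" using assms by simp
    have "sum ?p ?S = card A" "sum ?q ?S = card B"
      unfolding card_eq_sum using fin assms(1,2) by (intro sum.group; auto)+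
    then have eq: "sum ?p ?S = sum ?q ?S" using assms by simp
    have "\<exists>t\<in>?S. ?p t < ?q t"
    proof (rule ccontr)
      assume "\<not> ?thesis"
      then have le: "?q t \<le> ?p t" if "t \<in> ?S" for t using that by (meson not_le)
      have "sum ?q ?S < sum ?p ?S"
        using t0 le[of t0] le
        by (intro sum_strict_mono_ex1[OF fin] bexI[of _ t0] ballI) (simp_all add: order_le_less)
      with eq show False by simp
    qed
    then obtain t1 where t1: "?p t1 < ?q t1" by blast
    have "\<exists>t\<in>?S. ?q t < ?p t"
    proof (rule ccontr)
      assume "\<not> ?thesis"
      then have le: "?p t \<le> ?q t" if "t \<in> ?S" for t using that by (meson not_le)
      have "sum ?p ?S < sum ?q ?S"
        using t0 le[of t0] le
        by (intro sum_strict_mono_ex1[OF fin] bexI[of _ t0] ballI) (simp_all add: order_le_less)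
      with eq show False by simp
    qed
    then obtain t2 where t2: "?q t2 < ?p t2" by blast
    have "t1 \<noteq> t2" using t1 t2 by auto
    then have "?p t1 + ?p t2 = card ({x \<in> A. a x = t1} \<union> {x \<in> A. a x = t2})"
      using assms(1) by (subst card_Un_disjoint) auto
    also have "\<dots> \<le> m" unfolding assms(3)[symmetric] using assms(1) by (intro card_mono) auto
    finally have "?p t1 + ?q t2 < m" using t2 by linarith
    then consider "2 * ?p t1 < m" | "2 * ?q t2 < m" by linarith
    then show ?thesis using that(2)[OF t1] that(3)[OF t2] by cases
  qed
qed

section \<open>Spoiler's win against a non-isomorphic structure\<close>

locale two_structures = finite_structure L M k
  for L :: vocabulary and M :: "'a struct" and k :: nat +
  fixes N :: "'b struct"
  assumes finite_univ': "finite (univ N)"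
begin

text \<open>In each iteration \<open>detects_extend\<close> adds the new singletons at the old price
  and \<open>certified_detects\<close> raises the price by \<open>k - 1\<close>. The summand
  \<open>k\<close> of the budget covers \<open>certified_conflict\<close>.\<close>

lemma ex_forced_correspondence:
  assumes P: "P \<subseteq> univ M \<times> univ N" "\<not> conflict L M N P"
    and nowin: "\<not> ewin L M N (k + (k - 1) * (k - 1)) P" "\<not> ewin L N M (k + (k - 1) * (k - 1)) (P\<inverse>)"
  shows "i \<le> k - 1 \<Longrightarrow> \<exists>\<Gamma>. P \<subseteq> \<Gamma> \<and> \<Gamma> \<subseteq> univ M \<times> univ N \<and> fst ` \<Gamma> = forced i (fst ` P) \<and>
    \<not> conflict L M N \<Gamma> \<and> detects L M N P \<Gamma> (i * (k - 1))"
proof (induction i)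
  case 0
  then show ?case using P detects_self by (intro exI[of _ P]) auto
next
  case (Suc i)
  then obtain \<Gamma> where \<Gamma>: "P \<subseteq> \<Gamma>" "\<Gamma> \<subseteq> univ M \<times> univ N" "fst ` \<Gamma> = forced i (fst ` P)"
    "\<not> conflict L M N \<Gamma>" "detects L M N P \<Gamma> (i * (k - 1))" by auto
  let ?d = "i * (k - 1)"
  have "?d + (k - 1) \<le> (k - 1) * (k - 1)"
    using mult_le_mono1[OF Suc.prems, of "k - 1"] by simp
  \<comment> \<open>An iteration takes place only for \<open>k\<close> at least 2, so the budget
    also covers the two moves of the uniqueness argument.\<close>
  moreover have "2 \<le> k" using Suc.prems by simp
  ultimately have le: "1 + ?d \<le> k + (k - 1) * (k - 1)" "2 + ?d \<le> k + (k - 1) * (k - 1)"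
    "k + ?d \<le> k + (k - 1) * (k - 1)" by linarith+
  define \<Gamma>' where "\<Gamma>' = \<Gamma> \<union> {(s, w). s \<in> sg (forced i (fst ` P)) \<and> w \<in> univ N \<and>
    \<not> conflict L M N (insert (s, w) \<Gamma>)}"
  have "\<not> ewin L M N (1 + ?d) P" "\<not> ewin L N M (2 + ?d) (P\<inverse>)"
    using nowin le ewin_mono_rounds by blast+
  note ext = detects_extend[OF \<Gamma>(5,2) P(1) \<Gamma>(3) this, folded \<Gamma>'_def]
  have \<Gamma>'sub: "\<Gamma>' \<subseteq> univ M \<times> univ N"
    using \<Gamma>(2) singles_subset[of L M] unfolding \<Gamma>'_def by blast
  have nc: "\<not> conflict L M N \<Gamma>'"
  proof
    assume "conflict L M N \<Gamma>'"
    from certified_conflict[OF ext(1) \<Gamma>'sub P(1) this k_pos arity_le]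
    have "ewin L M N (k + ?d) P" .
    with nowin(1) le(3) show False using ewin_mono_rounds by blast
  qed
  have "detects L M N P \<Gamma>' (k - 1 + ?d)" by (rule certified_detects[OF ext(1) \<Gamma>'sub nc arity_le])
  then have "detects L M N P \<Gamma>' (Suc i * (k - 1))" by simp
  then show ?case using \<Gamma>(1) \<Gamma>'sub ext(2) nc by (intro exI[of _ \<Gamma>']) (auto simp: \<Gamma>'_def)
qed

lemma win_from_correspondence:
  assumes P: "P \<subseteq> univ M \<times> univ N" and \<Gamma>: "P \<subseteq> \<Gamma>" "\<Gamma> \<subseteq> univ M \<times> univ N" "fst ` \<Gamma> = T"
    "\<not> conflict L M N \<Gamma>" "detects L M N P \<Gamma> d"
    and T: "interchangeable T" and card: "card (univ N) = card V" and not_iso: "\<not> isomorphic L M N"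
  shows "ewin L M N ((card (V - T) + 1) div 2 + d) P \<or>
    ewin L N M ((card (V - T) + 1) div 2 + d) (P\<inverse>) \<or> ewin L N M (k + d) (P\<inverse>)"
proof -
  let ?ok = "\<lambda>p. \<not> conflict L M N (insert p \<Gamma>)"
  let ?T' = "snd ` \<Gamma>" and ?m = "card (V - T)"
  have TV: "T \<subseteq> V" "?T' \<subseteq> univ N" using \<Gamma>(2,3) by auto
  have clash: "\<not> eq_clash p q" if "p \<in> \<Gamma>" "q \<in> \<Gamma>" for p q
    using \<Gamma>(4) conflict_eq_clash that by blast
  have okD: "fst p = e \<longleftrightarrow> snd p = e'" if "?ok p" "(e, e') \<in> \<Gamma>" for p e e'
  proof -
    have "\<not> eq_clash p (e, e')" using that conflict_insert_eq_clash by blast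
    then show ?thesis by (simp add: eq_clash_def)
  qed
  have inT: "e \<in> T" if "(e, e') \<in> \<Gamma>" for e e'
    unfolding \<Gamma>(3)[symmetric] using that by (intro image_eqI[of _ _ "(e, e')"]) simp_all
  have ok_T: "x \<in> T \<longleftrightarrow> y \<in> ?T'" if "?ok (x, y)" for x y
  proof
    assume "x \<in> T"
    then obtain e' where e': "(x, e') \<in> \<Gamma>" using \<Gamma>(3) by auto
    then show "y \<in> ?T'" using okD[OF that e'] by (intro image_eqI[of _ _ "(x, e')"]) simp_all
  next
    assume "y \<in> ?T'"
    then obtain e where e: "(e, y) \<in> \<Gamma>" by auto
    then have "x = e" using okD[OF that e] by simp
    then show "x \<in> T" using inT[OF e] by simp
  qed
  have "\<forall>e\<in>T. \<exists>e'. (e, e') \<in> \<Gamma>" using \<Gamma>(3) by auto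
  then obtain g where g: "\<And>e. e \<in> T \<Longrightarrow> (e, g e) \<in> \<Gamma>" by metis
  have g_eq: "e' = g e" if "(e, e') \<in> \<Gamma>" for e e'
  proof -
    have "e \<in> T" using that by (rule inT)
    then show ?thesis using clash[OF that g[of e]] by (simp add: eq_clash_def)
  qed
  have g_bij: "bij_betw g T ?T'"
  proof (rule bij_betw_imageI)
    show "inj_on g T"
    proof (rule inj_onI)
      fix x y assume "x \<in> T" "y \<in> T" "g x = g y"
      then show "x = y" using clash[OF g g, of x y] by (simp add: eq_clash_def)
    qed
    show "g ` T = ?T'"
    proof
      show "g ` T \<subseteq> ?T'" using g by force
      show "?T' \<subseteq> g ` T"
      proof
        fix y assume "y \<in> ?T'"
        then obtain e where e: "(e, y) \<in> \<Gamma>" by auto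
        then have "e \<in> T" by (rule inT)
        with g_eq[OF e] show "y \<in> g ` T" by blast
      qed
    qed
  qed
  have "card (univ N - ?T') = card (univ N) - card ?T'"
    using TV finite_univ' by (intro card_Diff_subset) (auto intro: finite_subset)
  also have "card ?T' = card T" using bij_betw_same_card[OF g_bij] by simp
  also have "card (univ N) - card T = ?m"
    using TV finite_univ card by (subst card_Diff_subset) (auto intro: finite_subset)
  finally have card': "card (univ N - ?T') = ?m" .
  \<comment> \<open>Elements of both structures get types that are sets in \<open>M\<close>. An
    element of \<open>N\<close> compatible with nothing outside \<open>T\<close> has type
    \<open>{}\<close>, whose fibre in \<open>M\<close> is empty since each class \<open>a v\<close>
    contains \<open>v\<close>.\<close>
  define a where "a = sim_class L M T"
  define b where "b w = {v \<in> V - T. ?ok (v, w)}" for w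
  have type_iff: "?ok (v, w) \<longleftrightarrow> b w = a v" if v: "v \<in> V - T" for v w
  proof
    assume ok: "?ok (v, w)"
    have "?ok (x, w) \<longleftrightarrow> similar L M T v x" for x
    proof
      assume "?ok (x, w)"
      then show "similar L M T v x" using similar_of_common_partner[OF ok _ \<Gamma>(3)] by blast
    next
      assume "similar L M T v x"
      then have "similar L M (fst ` \<Gamma>) x v" unfolding \<Gamma>(3) by (rule similar_sym)
      then show "?ok (x, w)" using not_conflict_similar[OF ok] by blast
    qed
    then show "b w = a v" unfolding a_def b_def sim_class_def by blast
  next
    assume "b w = a v"
    moreover have "v \<in> a v" unfolding a_def sim_class_def using v by simp
    ultimately show "?ok (v, w)" unfolding b_def by blast
  qed
  have fins: "finite (V - T)" "finite (univ N - ?T')" using finite_univ finite_univ' by auto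
  show ?thesis
  proof (cases rule: bij_or_unequal_fibre[OF fins refl card', of b a, case_names 1 2 3])
    case (1 h)
    define \<phi> where "\<phi> x = (if x \<in> T then g x else h x)" for x
    have "bij_betw \<phi> (T \<union> (V - T)) (?T' \<union> (univ N - ?T'))"
      unfolding \<phi>_def by (rule bij_betw_disjoint_Un[OF g_bij 1(1)]) auto
    moreover have "T \<union> (V - T) = V" "?T' \<union> (univ N - ?T') = univ N" using TV by auto
    ultimately have \<phi>: "bij_betw \<phi> V (univ N)" by simp
    have ok\<phi>: "?ok (x, \<phi> x)" if "x \<in> V" for x
    proof (cases "x \<in> T")
      case True
      then have "insert (x, \<phi> x) \<Gamma> = \<Gamma>" using g[OF True] by (auto simp: \<phi>_def)
      then show ?thesis using \<Gamma>(4) by simp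
    next
      case False
      then show ?thesis using type_iff[of x "h x"] 1(2)[of x] that by (simp add: \<phi>_def)
    qed
    \<comment> \<open>The glued bijection respects types but is no isomorphism. Spoiler plays in
      \<open>N\<close> the image of a tuple that it violates.\<close>
    from not_iso \<phi> obtain i xs where i: "i < length L" and xs: "xs \<in> tuples V (L ! i)"
      and ne: "rel M i xs \<noteq> rel N i (map \<phi> xs)"
      unfolding isomorphic_def by blast
    have len: "length xs = L ! i" and xsV: "set xs \<subseteq> V" using xs by (auto simp: tuples_def)
    let ?F = "\<phi> ` set xs"
    have FN: "?F \<subseteq> univ N" using \<phi> xsV by (auto simp: bij_betw_def)
    have inj: "inj_on \<phi> (set xs)" using \<phi> xsV by (auto simp: bij_betw_def intro: inj_on_subset)
    have "ewin L N M (card ?F + d) (P\<inverse>)"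
    proof (rule ewin_play[OF _ FN])
      fix \<rho> assume \<rho>: "\<rho> ` ?F \<subseteq> univ M"
      let ?Q = "P\<inverse> \<union> (\<lambda>y. (y, \<rho> y)) ` ?F"
      have sub: "P \<subseteq> ?Q\<inverse>" "?Q\<inverse> \<subseteq> univ M \<times> univ N" using P \<rho> FN by auto
      show "ewin L N M d ?Q"
      proof (rule ccontr)
        assume nowin: "\<not> ewin L N M d ?Q"
        have ok: "?ok (\<rho> (\<phi> x), \<phi> x)" if "x \<in> set xs" for x
          using detectsD[OF \<Gamma>(5) sub, of "(\<rho> (\<phi> x), \<phi> x)"] nowin that by auto
        have nc: "\<not> conflict L N M ?Q" using nowin conflict_ewin by blast
        have "inj_on (\<rho> \<circ> \<phi>) (set xs)"
        proof (rule inj_onI)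
          fix x y assume xy: "x \<in> set xs" "y \<in> set xs" "(\<rho> \<circ> \<phi>) x = (\<rho> \<circ> \<phi>) y"
          have "\<not> eq_clash (\<phi> x, \<rho> (\<phi> x)) (\<phi> y, \<rho> (\<phi> y))"
            using conflict_eq_clash[of "(\<phi> x, \<rho> (\<phi> x))" ?Q "(\<phi> y, \<rho> (\<phi> y))"] nc xy by blast
          then have "\<phi> x = \<phi> y" using xy(3) by (simp add: eq_clash_def)
          then show "x = y" using inj xy by (auto dest: inj_onD)
        qed
        moreover have "(\<rho> \<circ> \<phi>) x = x \<or> x \<in> V - T \<and> (\<rho> \<circ> \<phi>) x \<in> V - T \<and> sim T x ((\<rho> \<circ> \<phi>) x)"
          if x: "x \<in> set xs" for x
        proof (cases "x \<in> T")
          case True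
          then have "(x, \<phi> x) \<in> \<Gamma>" using g by (simp add: \<phi>_def)
          from okD[OF ok[OF x] this] show ?thesis by simp
        next
          case False
          have xV: "x \<in> V" using x xsV by blast
          have "sim T x (\<rho> (\<phi> x))"
            by (rule similar_of_common_partner[OF ok\<phi>[OF xV] ok[OF x] \<Gamma>(3)])
          moreover have "\<rho> (\<phi> x) \<notin> T"
            using ok_T[OF ok[OF x]] ok_T[OF ok\<phi>[OF xV]] False by blast
          moreover have "\<rho> (\<phi> x) \<in> V" using \<rho> x by blast
          ultimately show ?thesis using False xV by simp
        qed
        \<comment> \<open>Undetected replies send each entry to itself or to a similar element, so
          by interchangeability the reply tuple behaves like \<open>xs\<close> in \<open>M\<close>.
          Absence of conflict transfers this to \<open>map \<phi> xs\<close> in \<open>N\<close>,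
          against the choice of \<open>xs\<close>.\<close>
        ultimately have "rel M i (map (\<rho> \<circ> \<phi>) xs) \<longleftrightarrow> rel M i xs"
          by (intro interchangeable_rel[OF T i len xsV])
        moreover have "rel N i (map \<phi> xs) \<longleftrightarrow> rel M i (map (\<rho> \<circ> \<phi>) xs)"
          by (rule not_conflict_relD[OF nc i len]) auto
        ultimately show False using ne by blast
      qed
    qed simp
    moreover have "card ?F \<le> k"
      using card_image_le[of "set xs" \<phi>] card_length[of xs] len arity_le[OF i] by simp
    ultimately have "ewin L N M (k + d) (P\<inverse>)" by (elim ewin_mono_rounds) simp
    then show ?thesis by blast
  next
    case (2 t)
    let ?G = "{x \<in> V - T. a x = t}" and ?H = "{y \<in> univ N - ?T'. b y = t}"
    from 2(1) have "Suc (card ?G) \<le> card ?H" by (rule Suc_leI)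
    \<comment> \<open>One element more than the fibre in \<open>M\<close> can hold: undetected
      replies stay in that fibre, so two of them coincide.\<close>
    then obtain F where F: "F \<subseteq> ?H" "card F = Suc (card ?G)" by (rule obtain_subset_with_card_n)
    have finF: "finite F" using F(2) card.infinite by fastforce
    have "ewin L N M (card F + d) (P\<inverse>)"
    proof (rule ewin_play[OF finF])
      show "F \<subseteq> univ N" using F(1) by blast
      fix \<rho> assume \<rho>: "\<rho> ` F \<subseteq> univ M"
      let ?Q = "P\<inverse> \<union> (\<lambda>y. (y, \<rho> y)) ` F"
      have sub: "P \<subseteq> ?Q\<inverse>" "?Q\<inverse> \<subseteq> univ M \<times> univ N" using P \<rho> F(1) by auto
      show "ewin L N M d ?Q"
      proof (rule ccontr)
        assume nowin: "\<not> ewin L N M d ?Q"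
        have "\<rho> y \<in> ?G" if y: "y \<in> F" for y
        proof -
          have ok: "?ok (\<rho> y, y)"
            using detectsD[OF \<Gamma>(5) sub, of "(\<rho> y, y)"] nowin y by auto
          have "\<rho> y \<in> V - T" using ok_T[OF ok] F(1) y \<rho> by blast
          moreover from this have "b y = a (\<rho> y)" using type_iff ok by blast
          ultimately show ?thesis using F(1) y by auto
        qed
        then have "\<rho> ` F \<subseteq> ?G" by (rule image_subsetI)
        moreover have "\<not> card F \<le> card ?G" using F(2) by simp
        ultimately have "\<not> inj_on \<rho> F" using card_inj_on_le[of \<rho> F ?G] finite_univ by auto
        then obtain y y' where "y \<in> F" "y' \<in> F" "\<rho> y = \<rho> y'" "y \<noteq> y'" unfolding inj_on_def by blast
        then have "conflict L N M ?Q"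
          by (intro conflict_eq_clash[of "(y, \<rho> y)" _ "(y', \<rho> y')"]) (auto simp: eq_clash_def)
        with nowin show False using conflict_ewin by blast
      qed
    qed
    \<comment> \<open>The fibre has strictly less than half of \<open>?m\<close> elements, so one
      more is at most half rounded up.\<close>
    moreover have "card F \<le> (?m + 1) div 2" using F(2) 2(2) by simp
    ultimately have "ewin L N M ((?m + 1) div 2 + d) (P\<inverse>)" by (elim ewin_mono_rounds) simp
    then show ?thesis by blast
  next
    case (3 t)
    let ?G = "{x \<in> V - T. a x = t}" and ?H = "{y \<in> univ N - ?T'. b y = t}"
    from 3(1) have "Suc (card ?H) \<le> card ?G" by (rule Suc_leI)
    then obtain F where F: "F \<subseteq> ?G" "card F = Suc (card ?H)" by (rule obtain_subset_with_card_n)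
    have finF: "finite F" using F(2) card.infinite by fastforce
    have "ewin L M N (card F + d) P"
    proof (rule ewin_play[OF finF])
      show "F \<subseteq> univ M" using F(1) by blast
      fix \<rho> assume \<rho>: "\<rho> ` F \<subseteq> univ N"
      let ?Q = "P \<union> (\<lambda>x. (x, \<rho> x)) ` F"
      have sub: "P \<subseteq> ?Q" "?Q \<subseteq> univ M \<times> univ N" using P \<rho> F(1) by auto
      show "ewin L M N d ?Q"
      proof (rule ccontr)
        assume nowin: "\<not> ewin L M N d ?Q"
        have "\<rho> x \<in> ?H" if x: "x \<in> F" for x
        proof -
          have ok: "?ok (x, \<rho> x)"
            using detectsD[OF \<Gamma>(5) sub, of "(x, \<rho> x)"] nowin x by auto
          have "x \<in> V - T" "a x = t" using F(1) x by auto
          moreover from this have "b (\<rho> x) = a x" using type_iff ok by blast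
          ultimately show ?thesis using ok_T[OF ok] \<rho> x by auto
        qed
        then have "\<rho> ` F \<subseteq> ?H" by (rule image_subsetI)
        moreover have "\<not> card F \<le> card ?H" using F(2) by simp
        ultimately have "\<not> inj_on \<rho> F" using card_inj_on_le[of \<rho> F ?H] finite_univ' by auto
        then obtain x x' where "x \<in> F" "x' \<in> F" "\<rho> x = \<rho> x'" "x \<noteq> x'" unfolding inj_on_def by blast
        then have "conflict L M N ?Q"
          by (intro conflict_eq_clash[of "(x, \<rho> x)" _ "(x', \<rho> x')"]) (auto simp: eq_clash_def)
        with nowin show False using conflict_ewin by blast
      qed
    qed
    moreover have "card F \<le> (?m + 1) div 2" using F(2) 3(2) by simp
    ultimately have "ewin L M N ((?m + 1) div 2 + d) P" by (elim ewin_mono_rounds) simp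
    then show ?thesis by blast
  qed
qed

text \<open>After \<open>X\<close>, the budget \<open>k\<close> serves the forced correspondence and
  a violated tuple, the other argument of \<open>max\<close> the overfilling of a class;
  \<open>(k - 1) * (k - 1)\<close> is the detection price after all iterations.\<close>

lemma eawin_of_not_isomorphic:
  assumes X: "X \<subseteq> V" "interchangeable (forced (k - 1) X)"
    and card: "card (univ N) = card V" and not_iso: "\<not> isomorphic L M N"
  shows "eawin L M N (card X)
    (max k ((card (V - forced (k - 1) X) + 1) div 2) + (k - 1) * (k - 1)) {}"
proof (rule eawin_play[OF _ X(1)])
  show "finite X" using X(1) finite_univ finite_subset by blast
  let ?m = "(card (V - forced (k - 1) X) + 1) div 2" and ?d = "(k - 1) * (k - 1)"
  fix \<rho> assume \<rho>: "\<rho> ` X \<subseteq> univ N"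
  define P where "P = (\<lambda>a. (a, \<rho> a)) ` X"
  have P: "P \<subseteq> univ M \<times> univ N" "fst ` P = X"
    unfolding P_def using X(1) \<rho> by (auto simp: image_image)
  have le: "k + ?d \<le> max k ?m + ?d" "?m + ?d \<le> max k ?m + ?d" by auto
  have "eawin L M N 0 (max k ?m + ?d) P"
  proof (rule ccontr)
    assume "\<not> ?thesis"
    then have nowin: "\<not> ewin L M N (max k ?m + ?d) P" "\<not> ewin L N M (max k ?m + ?d) (P\<inverse>)"
      by simp_all
    then have nc: "\<not> conflict L M N P" using conflict_ewin by blast
    have nowin_m: "\<not> ewin L M N (?m + ?d) P" "\<not> ewin L N M (?m + ?d) (P\<inverse>)"
      using nowin ewin_mono_rounds[OF _ le(2)] by blast+
    have nowin_k: "\<not> ewin L M N (k + ?d) P" "\<not> ewin L N M (k + ?d) (P\<inverse>)"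
      using nowin ewin_mono_rounds[OF _ le(1)] by blast+
    from ex_forced_correspondence[OF P(1) nc nowin_k order_refl] obtain \<Gamma> where "P \<subseteq> \<Gamma>"
      "\<Gamma> \<subseteq> univ M \<times> univ N" "fst ` \<Gamma> = forced (k - 1) X" "\<not> conflict L M N \<Gamma>"
      "detects L M N P \<Gamma> ?d" unfolding P(2) by blast
    from win_from_correspondence[OF P(1) this X(2) card not_iso]
    show False using nowin_m nowin_k by blast
  qed
  then show "eawin L M N 0 (max k ?m + ?d) ({} \<union> (\<lambda>a. (a, \<rho> a)) ` X)" unfolding P_def by simp
qed

end

section \<open>From the game to an identifying formula\<close>

text \<open>Bounding each word instead of the maxima makes closure under conjunction
  immediate.\<close>

definition good_formula :: "vocabulary \<Rightarrow> real \<Rightarrow> fm \<Rightarrow> bool" where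
  "good_formula L \<beta> \<phi> \<longleftrightarrow>
     sentence L \<phi> \<and> (\<forall>w\<in>nest \<phi>. real (length w) < \<beta> \<and> alternations w \<le> 1)"

lemma eawin_good_formula:
  fixes M :: "'a struct" and N :: "'b struct"
  assumes "eawin L M N s r {}" "finite (univ M)" "finite (univ N)" "real (s + r) < \<beta>"
  shows "\<exists>\<phi>. good_formula L \<beta> \<phi> \<and> sat M \<sigma> \<phi> \<and> \<not> sat N \<tau> \<phi>"
proof -
  have "eawin L M N s r ((\<lambda>i. (\<sigma> i, \<tau> i)) ` {..<0})" using assms(1) by simp
  from eawin_formula[OF this assms(2,3)] obtain \<phi> where \<phi>: "formula L \<phi>" "fv \<phi> \<subseteq> {..<0}"
    "nest \<phi> \<subseteq> {replicate i Ex_q @ replicate j q |i j q. i \<le> s \<and> j \<le> r}" "sat M \<sigma> \<phi>"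
    "\<not> sat N \<tau> \<phi>" by blast
  have "real (length w) < \<beta> \<and> alternations w \<le> 1" if "w \<in> nest \<phi>" for w
  proof -
    from that \<phi>(3) obtain i j q where w: "w = replicate i Ex_q @ replicate j q" "i \<le> s" "j \<le> r" by blast
    then show ?thesis using assms(4) alternations_two_blocks[of i Ex_q j q] by simp
  qed
  with \<phi> have "good_formula L \<beta> \<phi>" by (simp add: good_formula_def sentence_def)
  with \<phi> show ?thesis by blast
qed

text \<open>Relations are false off the tuples over \<open>V\<close>, so a structure on
  \<open>V\<close> is determined by a subset of a finite set.\<close>

lemma finite_structures_on:
  assumes "finite V"
  shows "finite {N :: 'a struct. is_structure L N \<and> univ N = V}"
proof (rule finite_imageD)
  let ?f = "\<lambda>N :: 'a struct. {(i, xs). rel N i xs}"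
  have "?f ` {N. is_structure L N \<and> univ N = V} \<subseteq> Pow (Sigma {..<length L} (\<lambda>i. tuples V (L ! i)))"
    by (auto simp: is_structure_def)
  moreover have "finite (tuples V l)" for l
    using finite_lists_length_eq[OF assms, of l] by (simp add: tuples_def conj_commute)
  ultimately show "finite (?f ` {N. is_structure L N \<and> univ N = V})"
    by (meson finite_Pow_iff finite_SigmaI finite_lessThan finite_subset)
  show "inj_on ?f {N. is_structure L N \<and> univ N = V}"
  proof (rule inj_onI)
    fix N N' :: "'a struct"
    assume "N \<in> {N. is_structure L N \<and> univ N = V}" "N' \<in> {N. is_structure L N \<and> univ N = V}"
      and f: "?f N = ?f N'"
    moreover have "rel N i xs = rel N' i xs" for i xs
      using f by (simp add: set_eq_iff)
    then have "rel N = rel N'" by (intro ext)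
    ultimately show "N = N'" by (intro struct.equality) auto
  qed
qed

lemma isomorphic_trans:
  assumes "isomorphic L M N" "isomorphic L N K"
  shows "isomorphic L M K"
proof -
  from assms obtain f g where f: "bij_betw f (univ M) (univ N)"
    "\<forall>i<length L. \<forall>xs\<in>tuples (univ M) (L ! i). rel M i xs \<longleftrightarrow> rel N i (map f xs)"
    and g: "bij_betw g (univ N) (univ K)"
    "\<forall>i<length L. \<forall>xs\<in>tuples (univ N) (L ! i). rel N i xs \<longleftrightarrow> rel K i (map g xs)"
    unfolding isomorphic_def by blast
  have "map f xs \<in> tuples (univ N) l" if "xs \<in> tuples (univ M) l" for xs l
    using that f(1) by (auto simp: tuples_def bij_betw_def)
  then have "rel M i xs \<longleftrightarrow> rel K i (map (g \<circ> f) xs)"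
    if "i < length L" "xs \<in> tuples (univ M) (L ! i)" for i xs
    using that f(2) g(2) by (metis map_map)
  then show ?thesis unfolding isomorphic_def using bij_betw_trans[OF f(1) g(1)] by blast
qed

lemma ex_copy_on:
  assumes "is_structure L N" "card (univ N) = card V" "finite V"
  obtains P :: "'a struct" where "is_structure L P" "univ P = V" "isomorphic L P N"
proof -
  from assms obtain g where g: "bij_betw g V (univ N)"
    unfolding is_structure_def using finite_same_card_bij by metis
  define P :: "'a struct" where "P = \<lparr>univ = V,
    rel = \<lambda>i xs. i < length L \<and> xs \<in> tuples V (L ! i) \<and> rel N i (map g xs)\<rparr>"
  have "is_structure L P" using assms(3) by (auto simp: is_structure_def P_def)
  moreover have "isomorphic L P N"
    unfolding isomorphic_def using g by (intro exI[of _ g]) (auto simp: P_def)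
  ultimately show thesis using that by (simp add: P_def)
qed

text \<open>By \<open>ex_copy_on\<close> it suffices to exclude the structures on
  \<open>univ M\<close> itself. There are finitely many, so the conjunction of their distinguishing
  formulas identifies \<open>M\<close>, without increase in rank or alternation.\<close>

lemma W_less_of_game:
  fixes M :: "'a struct"
  assumes M: "is_structure L M" and \<beta>: "1 < \<beta>"
    and win: "\<And>N :: 'a struct. is_structure L N \<Longrightarrow> univ N = univ M \<Longrightarrow> \<not> isomorphic L M N \<Longrightarrow>
      \<exists>s r. eawin L M N s r {} \<and> real (s + r) < \<beta>"
  shows "ereal_of_enat (W 1 L M) < ereal \<beta>"
proof -
  have finM: "finite (univ M)" using M by (simp add: is_structure_def)
  let ?S = "{N :: 'a struct. is_structure L N \<and> univ N = univ M} \<inter> {N. \<not> isomorphic L M N}"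
  \<comment> \<open>When nothing has to be excluded, the valid sentence
    \<open>Uni 0 (Eq 0 0)\<close> is taken; its rank 1 explains the hypothesis on
    \<open>\<beta>\<close>.\<close>
  have "\<exists>\<phi>. good_formula L \<beta> \<phi> \<and> sat M undefined \<phi> \<and> (\<forall>N\<in>?S. \<not> sat N undefined \<phi>)"
  proof (rule ex_conj_formula[where \<psi> = "Uni 0 (Eq 0 0)"])
    show "finite ?S" using finite_structures_on[OF finM] by simp
    show "good_formula L \<beta> (Uni 0 (Eq 0 0))"
      using \<beta> by (simp add: good_formula_def sentence_def alternations_def)
    show "good_formula L \<beta> (Conj \<phi> \<psi>)" if "good_formula L \<beta> \<phi>" "good_formula L \<beta> \<psi>" for \<phi> \<psi>
      using that by (auto simp: good_formula_def sentence_def)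
    show "\<exists>\<phi>. good_formula L \<beta> \<phi> \<and> sat M undefined \<phi> \<and> \<not> sat N undefined \<phi>" if "N \<in> ?S" for N
    proof -
      from that have N: "is_structure L N" "univ N = univ M" "\<not> isomorphic L M N" by auto
      from win[OF this] obtain s r where "eawin L M N s r {}" "real (s + r) < \<beta>" by blast
      then show ?thesis using eawin_good_formula finM N(2) by metis
    qed
  qed simp
  then obtain \<phi> where \<phi>: "good_formula L \<beta> \<phi>" "sat M undefined \<phi>" "\<forall>N\<in>?S. \<not> sat N undefined \<phi>"
    by blast
  have sent: "sentence L \<phi>" using \<phi>(1) by (simp add: good_formula_def)
  have "identifies L \<phi> M" unfolding identifies_def
  proof (intro conjI sent allI impI)
    fix N :: "'a struct"
    assume N: "is_structure L N \<and> card (univ N) = card (univ M) \<and> \<not> isomorphic L M N"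
    then obtain P :: "'a struct" where P: "is_structure L P" "univ P = univ M" "isomorphic L P N"
      using ex_copy_on[OF _ _ finM, of L N] by blast
    have "P \<in> ?S" using P N isomorphic_trans by blast
    then have "\<not> true_on P \<phi>" using \<phi>(3) true_on_iff[OF sent] by blast
    then have "\<not> true_on N \<phi>" using true_on_isomorphic[OF P(3) sent] by blast
    moreover have "true_on M \<phi>" using \<phi>(2) true_on_iff[OF sent] by blast
    ultimately show "distinguishes \<phi> M N" by (simp add: distinguishes_def)
  qed
  moreover have "alternation_number \<phi> \<le> 1"
    unfolding alternation_number_def using \<phi>(1) finite_nest[of \<phi>] nest_nonempty[of \<phi>]
    by (simp add: good_formula_def)
  ultimately have "W 1 L M \<le> enat (quantifier_rank \<phi>)"
    unfolding W_def by (intro INF_lower) simp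
  then have "ereal_of_enat (W 1 L M) \<le> ereal (real (quantifier_rank \<phi>))"
    by (metis ereal_of_enat_le_iff ereal_of_enat_simps(1))
  also have "quantifier_rank \<phi> \<in> length ` nest \<phi>"
    unfolding quantifier_rank_def using finite_nest[of \<phi>] nest_nonempty[of \<phi>] by (intro Max_in) auto
  then have "real (quantifier_rank \<phi>) < \<beta>" using \<phi>(1) by (auto simp: good_formula_def)
  then have "ereal (real (quantifier_rank \<phi>)) < ereal \<beta>" by simp
  finally show ?thesis .
qed

section \<open>Counting the rounds\<close>

lemma round_count_bound:
  fixes k n x t m :: nat
  assumes "0 < k" "n = x + t + m" "x \<le> (k - 1) * (t + (t + m))"
  shows "real (x + (max k ((m + 1) div 2) + (k - 1) * (k - 1)))
    < (1 - 1 / (2 * real k)) * real n + real k ^ 2 - real k + 2"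
proof -
  obtain j where k: "k = Suc j" using assms(1) by (cases k) auto
  let ?K = "real k"
  have x: "real x \<le> real j * (2 * real t + real m)"
  proof -
    have "real x \<le> real ((k - 1) * (t + (t + m)))" using assms(3) by (simp only: of_nat_le_iff)
    also have "\<dots> = real j * (2 * real t + real m)" by (simp add: k algebra_simps)
    finally show ?thesis .
  qed
  \<comment> \<open>Multiplied by \<open>2 * ?K\<close>, this reduces to \<open>x\<close> being at
    most \<open>(2 * j + 1) * t + j * m\<close>, which the bound on \<open>x\<close>
    implies.\<close>
  have "real x + real m / 2 \<le> (1 - 1 / (2 * ?K)) * real n"
  proof -
    have "2 * ?K * real x + ?K * real m \<le> (2 * ?K - 1) * real n"
    proof -
      have "(2 * ?K - 1) * real n - (2 * ?K * real x + ?K * real m)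
        = (2 * real j + 1) * real t + real j * real m - real x"
        unfolding assms(2) k by (simp add: algebra_simps)
      also have "\<dots> \<ge> 0" using x by (simp add: algebra_simps)
      finally show ?thesis by simp
    qed
    then show ?thesis using assms(1) by (simp add: field_simps)
  qed
  moreover have "real ((m + 1) div 2) \<le> (real m + 1) / 2"
    using of_nat_div_le_of_nat[of "m + 1" 2, where ?'a = real] by simp
  moreover have "real x \<le> (1 - 1 / (2 * ?K)) * real n"
    using calculation(1) of_nat_0_le_iff[of m, where ?'a = real] by linarith
  moreover have "real ((k - 1) * (k - 1)) = ?K ^ 2 - 2 * ?K + 1"
    unfolding k by (simp add: power2_eq_square algebra_simps)
  moreover have "1 \<le> ?K" using assms(1) by simp
  \<comment> \<open>If the maximum is \<open>k\<close>, the constant is \<open>k\<close> plus the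
    square of \<open>k - 1\<close>, which is one below the allowed constant. Otherwise rounding adds
    at most one half to \<open>m / 2\<close>.\<close>
  ultimately show ?thesis unfolding of_nat_add of_nat_max by linarith
qed

theorem theorem4p1:
  fixes L :: vocabulary and M :: "'a struct" and k n :: nat
  assumes "is_vocabulary L" and "L \<noteq> []" and "max_arity L = k"
    and "is_structure L M" and "card (univ M) = n"
  shows "ereal_of_enat (W 1 L M) < ereal ((1 - 1 / (2 * real k)) * real n + real k ^ 2 - real k + 2)"
proof (rule W_less_of_game[OF assms(4)])
  have "k \<in> set L" using assms(2,3) unfolding max_arity_def by (metis List.finite_set Max_in set_empty)
  then have k: "0 < k" using assms(1) by (simp add: is_vocabulary_def)
  have arity: "L ! i \<le> k" if "i < length L" for i
    using assms(3) that unfolding max_arity_def by (metis List.finite_set Max_ge nth_mem)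
  have finM: "finite (univ M)" using assms(4) by (simp add: is_structure_def)
  interpret finite_structure L M k using finM k arity by unfold_locales
  have "0 \<le> (1 - 1 / (2 * real k)) * real n" using k by simp
  moreover have "0 \<le> real k ^ 2 - real k" using k by (simp add: power2_eq_square)
  ultimately show "1 < (1 - 1 / (2 * real k)) * real n + real k ^ 2 - real k + 2" by linarith
  fix N :: "'a struct"
  assume N: "is_structure L N" "univ N = univ M" "\<not> isomorphic L M N"
  interpret two_structures L M k N using N(2) finM by unfold_locales simp
  obtain X where X: "X \<subseteq> V" "interchangeable (forced (k - 1) X)"
    "card X \<le> (k - 1) * (card (forced (k - 1) X - X) + card (V - X))"
    using ex_base by blast
  let ?T = "forced (k - 1) X"
  have XT: "X \<subseteq> ?T" "?T \<subseteq> V" using subset_forced forced_subset[OF X(1)] by auto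
  have fin: "finite X" "finite ?T" using XT finM by (auto intro: finite_subset)
  have "card (V - X) = card (?T - X) + card (V - ?T)"
    using XT fin finM by (subst card_Un_disjoint[symmetric]) (auto intro: arg_cong[of _ _ card])
  moreover have "n = card X + card (V - X)"
    using assms(5) card_mono[OF finM X(1)] card_Diff_subset[OF fin(1) X(1)] by simp
  ultimately have "real (card X + (max k ((card (V - ?T) + 1) div 2) + (k - 1) * (k - 1)))
    < (1 - 1 / (2 * real k)) * real n + real k ^ 2 - real k + 2"
    using X(3) by (intro round_count_bound[OF k]) simp_all
  moreover have "eawin L M N (card X) (max k ((card (V - ?T) + 1) div 2) + (k - 1) * (k - 1)) {}"
    using eawin_of_not_isomorphic[OF X(1,2)] N by simp
  ultimately show "\<exists>s r. eawin L M N s r {} \<and>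
    real (s + r) < (1 - 1 / (2 * real k)) * real n + real k ^ 2 - real k + 2" by blast
qed

end
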